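(* Let $A$ be a symmetric $d\times d$ matrix with $\alpha I_d\preceq A\preceq\beta I_d$, $0<\alpha\le\beta$, and consider the chain $X_{k+1}=X_k-\eta AX_k+\sqrt{2\eta}\,\xi_{k+1}$, $k\ge0$, where $(\xi_k)_{k\ge1}$ are i.i.d. $N(0,I_d)$ independent of $X_0$. Suppose $X_0$ has zero mean and $\mathbb{E}|X_0|^2\le Cd$. Let $W_n=\eta^{1/2}n^{-1/2}\sum_{i=0}^{n-1}X_i$, $\Sigma=2A^{-2}$, and $n=\lfloor\eta^{-p}\rfloor$ with $p>1$. Then \[ \mathcal W_2(\Sigma^{-1/2}W_n,\gamma)\le C\big(n^{\frac1p-1}d^{3/2}+n^{\frac{1}{2p}-\frac12}d^{1/2}\big). \] Moreover, if $X_0\sim N(0,\Sigma_0)$ with $0\prec\Sigma_0\preceq CI_d$, then $\mathcal W_2(\Sigma^{-1/2}W_n,\gamma)\le Cn^{\frac1p-1}d^{3/2}$.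
   Context: $\gamma$ is the standard Gaussian law on $\mathbb{R}^d$ and $\mathcal W_2$ the 2-Wasserstein distance. $C$ denotes positive constants not depending on $d,n,\eta$ (depending only on $\alpha,\beta$ and the constants in the hypotheses). This is the case $U(x)=\frac12x^\top Ax$, whose Gibbs measure has mean zero. $A\preceq B$ means $B-A$ is positive semidefinite, $A\prec B$ that it is positive definite. *)

theory Defs
  imports "HOL-Probability.Probability"
begin

text \<open>Vectors of R^d are functions nat => real, extensional outside {..<d}
  (the carrier of the product measure below); d x d matrices are nat => nat => real,
  only entries with indices < d matter (results of matrix operations are 0 outside).\<close>

definition Rd :: "nat \<Rightarrow> (nat \<Rightarrow> real) measure" where
  "Rd d = PiM {..<d} (\<lambda>_. lborel)"

definition gauss :: "nat \<Rightarrow> (nat \<Rightarrow> real) measure" where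
  "gauss d = PiM {..<d} (\<lambda>_. density lborel std_normal_density)"

definition mat_mult :: "nat \<Rightarrow> (nat \<Rightarrow> nat \<Rightarrow> real) \<Rightarrow> (nat \<Rightarrow> nat \<Rightarrow> real) \<Rightarrow> nat \<Rightarrow> nat \<Rightarrow> real" where
  "mat_mult d M N = (\<lambda>i j. if i < d \<and> j < d then \<Sum>k<d. M i k * N k j else 0)"

definition mat_id :: "nat \<Rightarrow> nat \<Rightarrow> nat \<Rightarrow> real" where
  "mat_id d = (\<lambda>i j. if i < d \<and> j < d \<and> i = j then 1 else 0)"

definition mat_vec :: "nat \<Rightarrow> (nat \<Rightarrow> nat \<Rightarrow> real) \<Rightarrow> (nat \<Rightarrow> real) \<Rightarrow> nat \<Rightarrow> real" where
  "mat_vec d M v = (\<lambda>i. if i < d then \<Sum>j<d. M i j * v j else undefined)"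

definition dmat :: "nat \<Rightarrow> (nat \<Rightarrow> nat \<Rightarrow> real) \<Rightarrow> bool" where
  "dmat d M \<longleftrightarrow> (\<forall>i j. (d \<le> i \<or> d \<le> j) \<longrightarrow> M i j = 0)"

definition symmetric_mat :: "nat \<Rightarrow> (nat \<Rightarrow> nat \<Rightarrow> real) \<Rightarrow> bool" where
  "symmetric_mat d M \<longleftrightarrow> (\<forall>i<d. \<forall>j<d. M i j = M j i)"

definition quad :: "nat \<Rightarrow> (nat \<Rightarrow> nat \<Rightarrow> real) \<Rightarrow> (nat \<Rightarrow> real) \<Rightarrow> real" where
  "quad d M x = (\<Sum>i<d. \<Sum>j<d. x i * M i j * x j)"

definition loewner_le :: "nat \<Rightarrow> (nat \<Rightarrow> nat \<Rightarrow> real) \<Rightarrow> (nat \<Rightarrow> nat \<Rightarrow> real) \<Rightarrow> bool" where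
  "loewner_le d M N \<longleftrightarrow> (\<forall>x. quad d M x \<le> quad d N x)"

definition psd :: "nat \<Rightarrow> (nat \<Rightarrow> nat \<Rightarrow> real) \<Rightarrow> bool" where
  "psd d M \<longleftrightarrow> symmetric_mat d M \<and> (\<forall>x. 0 \<le> quad d M x)"

definition pos_def :: "nat \<Rightarrow> (nat \<Rightarrow> nat \<Rightarrow> real) \<Rightarrow> bool" where
  "pos_def d M \<longleftrightarrow> symmetric_mat d M \<and> (\<forall>x. (\<exists>i<d. x i \<noteq> 0) \<longrightarrow> 0 < quad d M x)"

definition scal_id :: "nat \<Rightarrow> real \<Rightarrow> nat \<Rightarrow> nat \<Rightarrow> real" where
  "scal_id d c = (\<lambda>i j. c * mat_id d i j)"

definition mat_inverse :: "nat \<Rightarrow> (nat \<Rightarrow> nat \<Rightarrow> real) \<Rightarrow> nat \<Rightarrow> nat \<Rightarrow> real" where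
  "mat_inverse d M = (THE N. dmat d N \<and> mat_mult d M N = mat_id d \<and> mat_mult d N M = mat_id d)"

definition mat_sqrt :: "nat \<Rightarrow> (nat \<Rightarrow> nat \<Rightarrow> real) \<Rightarrow> nat \<Rightarrow> nat \<Rightarrow> real" where
  "mat_sqrt d M = (THE S. dmat d S \<and> psd d S \<and> (\<forall>i<d. \<forall>j<d. mat_mult d S S i j = M i j))"

definition Sigma :: "nat \<Rightarrow> (nat \<Rightarrow> nat \<Rightarrow> real) \<Rightarrow> nat \<Rightarrow> nat \<Rightarrow> real" where
  "Sigma d A = (\<lambda>i j. 2 * mat_mult d (mat_inverse d A) (mat_inverse d A) i j)"

definition Sigma_inv_half :: "nat \<Rightarrow> (nat \<Rightarrow> nat \<Rightarrow> real) \<Rightarrow> nat \<Rightarrow> nat \<Rightarrow> real" where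
  "Sigma_inv_half d A = mat_inverse d (mat_sqrt d (Sigma d A))"

definition gaussian_law :: "nat \<Rightarrow> (nat \<Rightarrow> nat \<Rightarrow> real) \<Rightarrow> (nat \<Rightarrow> real) measure" where
  "gaussian_law d S = distr (gauss d) (Rd d) (mat_vec d (mat_sqrt d S))"

definition couplings :: "nat \<Rightarrow> (nat \<Rightarrow> real) measure \<Rightarrow> (nat \<Rightarrow> real) measure
    \<Rightarrow> ((nat \<Rightarrow> real) \<times> (nat \<Rightarrow> real)) measure set" where
  "couplings d \<mu> \<nu> = {\<pi>. sets \<pi> = sets (Rd d \<Otimes>\<^sub>M Rd d) \<and> prob_space \<pi>
       \<and> distr \<pi> (Rd d) fst = \<mu> \<and> distr \<pi> (Rd d) snd = \<nu>}"

definition W2_sq :: "nat \<Rightarrow> (nat \<Rightarrow> real) measure \<Rightarrow> (nat \<Rightarrow> real) measure \<Rightarrow> ennreal" where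
  "W2_sq d \<mu> \<nu> = (INF \<pi>\<in>couplings d \<mu> \<nu>.
      \<integral>\<^sup>+ z. ennreal (\<Sum>i<d. (fst z i - snd z i)\<^sup>2) \<partial>\<pi>)"

text \<open>Canonical probability space for the chain: omega = (X_0, (xi_k)_k), with
  X_0 ~ mu0 independent of the i.i.d. standard Gaussians xi_k (xi_0 is unused).\<close>
definition chain_space :: "nat \<Rightarrow> (nat \<Rightarrow> real) measure
    \<Rightarrow> ((nat \<Rightarrow> real) \<times> (nat \<Rightarrow> nat \<Rightarrow> real)) measure" where
  "chain_space d \<mu>0 = \<mu>0 \<Otimes>\<^sub>M PiM UNIV (\<lambda>_::nat. gauss d)"

primrec chain :: "nat \<Rightarrow> (nat \<Rightarrow> nat \<Rightarrow> real) \<Rightarrow> real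
    \<Rightarrow> (nat \<Rightarrow> real) \<times> (nat \<Rightarrow> nat \<Rightarrow> real) \<Rightarrow> nat \<Rightarrow> nat \<Rightarrow> real" where
  "chain d A \<eta> \<omega> 0 = fst \<omega>"
| "chain d A \<eta> \<omega> (Suc k) = (\<lambda>i. if i < d then
      chain d A \<eta> \<omega> k i - \<eta> * (\<Sum>j<d. A i j * chain d A \<eta> \<omega> k j)
      + sqrt (2 * \<eta>) * snd \<omega> (Suc k) i else undefined)"

definition Wn :: "nat \<Rightarrow> (nat \<Rightarrow> nat \<Rightarrow> real) \<Rightarrow> real \<Rightarrow> nat
    \<Rightarrow> (nat \<Rightarrow> real) \<times> (nat \<Rightarrow> nat \<Rightarrow> real) \<Rightarrow> nat \<Rightarrow> real" where
  "Wn d A \<eta> n \<omega> = (\<lambda>j. if j < d then sqrt \<eta> / sqrt (real n) * (\<Sum>i<n. chain d A \<eta> \<omega> i j)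
      else undefined)"

definition normalized_law :: "nat \<Rightarrow> (nat \<Rightarrow> nat \<Rightarrow> real) \<Rightarrow> real \<Rightarrow> nat
    \<Rightarrow> (nat \<Rightarrow> real) measure \<Rightarrow> (nat \<Rightarrow> real) measure" where
  "normalized_law d A \<eta> n \<mu>0 =
     distr (chain_space d \<mu>0) (Rd d) (\<lambda>\<omega>. mat_vec d (Sigma_inv_half d A) (Wn d A \<eta> n \<omega>))"

definition good_A :: "real \<Rightarrow> real \<Rightarrow> nat \<Rightarrow> (nat \<Rightarrow> nat \<Rightarrow> real) \<Rightarrow> bool" where
  "good_A \<alpha> \<beta> d A \<longleftrightarrow> symmetric_mat d A \<and> loewner_le d (scal_id d \<alpha>) A
      \<and> loewner_le d A (scal_id d \<beta>)"

end

theory Submission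
  imports Defs
begin

text \<open>With \<open>B = I - \<eta> A\<close>, summing the recursion telescopes to
  \<open>\<eta> A \<Sum>\<^sub>i X\<^sub>i = X\<^sub>0 - X\<^sub>n + (2 \<eta>)\<^sup>1\<^sup>/\<^sup>2 \<Sum>\<^sub>k \<xi>\<^sub>k\<close>, and \<open>\<Sigma>\<^sup>-\<^sup>1\<^sup>/\<^sup>2 = A / \<surd>2\<close>, so the normalized average is
  \<open>n\<^sup>-\<^sup>1\<^sup>/\<^sup>2 \<Sum>\<^sub>k \<xi>\<^sub>k + (X\<^sub>0 - X\<^sub>n) / (2 \<eta> n)\<^sup>1\<^sup>/\<^sup>2\<close>. The first term has law \<open>\<gamma>\<close> and the
  second moment of \<open>X\<^sub>0 - X\<^sub>n\<close> is \<open>O(d)\<close>, which gives the first bound by the synchronous coupling,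
  because \<open>1 / (\<eta> n)\<close> is of order \<open>n\<^sup>1\<^sup>/\<^sup>p\<^sup>-\<^sup>1\<close>.
  For Gaussian \<open>X\<^sub>0\<close> the normalized average is centred Gaussian with covariance
  \<open>S = (I - B\<^sup>n) \<Sigma>\<^sub>0 (I - B\<^sup>n) / (2 \<eta> n) + (1/n) \<Sum>\<^bsub>m<n\<^esub> (I - B\<^sup>m)\<^sup>2\<close>, and \<open>\<parallel>S - I\<parallel> = O(1 / (\<eta> n))\<close> in operator
  norm since the powers of \<open>B\<close> are summable. By uniqueness of characteristic functions it has the law of
  \<open>S\<^sup>1\<^sup>/\<^sup>2 Z\<close>, \<open>Z\<close> standard Gaussian, and coupling with \<open>Z\<close> costs
  \<open>\<parallel>S\<^sup>1\<^sup>/\<^sup>2 - I\<parallel> \<le> \<parallel>S - I\<parallel>\<close> in Frobenius norm.\<close>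

section \<open>Matrices\<close>

text \<open>The inverse and the square root are specified by \<open>THE\<close>, so existence and
  uniqueness must both be supplied. Existence comes from the binomial series rather than from
  diagonalization: if N has norm at most 1 (strictly less for negative exponents), the powers of I -
  N are given by series whose exponents add under multiplication. Exponent 1/2 yields the root, 1/4
  certifies its positivity, and -1 yields the inverse of \<open>A\<close>. The Gaussian case gains
  because W_2 sees only laws. Pathwise, the boundary term has size (d / (\<eta> n))^(1/2), and the
  synchronous coupling pays that in full. In the covariance it enters through its square and through
  its correlation with the noise average. Both are O(1 / (\<eta> n)), the correlation because each
  noise variable is damped by a power of B and these powers sum to O(1 / \<eta>). The range 0 <
  \<eta> \<le> 1 contains steps for which B expands, so one constant \<open>D\<close> depending on
  \<alpha>, \<beta>, p alone has to control the powers up to n and their sum in every case.\<close>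

definition dot :: "nat \<Rightarrow> (nat \<Rightarrow> real) \<Rightarrow> (nat \<Rightarrow> real) \<Rightarrow> real" where
  "dot d x y = (\<Sum>i<d. x i * y i)"

text \<open>Unlike \<open>mat_vec\<close> there is no case split on the index, so linearity holds as
  an equation between functions. Components beyond \<open>d\<close> are arbitrary and invisible to
  \<open>dot\<close>.\<close>

definition mv :: "nat \<Rightarrow> (nat \<Rightarrow> nat \<Rightarrow> real) \<Rightarrow> (nat \<Rightarrow> real) \<Rightarrow> nat \<Rightarrow> real" where
  "mv d M v = (\<lambda>i. \<Sum>j<d. M i j * v j)"

primrec mpow :: "nat \<Rightarrow> (nat \<Rightarrow> nat \<Rightarrow> real) \<Rightarrow> nat \<Rightarrow> nat \<Rightarrow> nat \<Rightarrow> real" where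
  "mpow d M 0 = mat_id d"
| "mpow d M (Suc k) = mat_mult d M (mpow d M k)"

text \<open>The Euclidean operator norm is at most \<open>r\<close>, in squared form to avoid roots.
  Nonnegativity of \<open>r\<close> is built in so that bounds can be multiplied.\<close>

definition op_bound :: "nat \<Rightarrow> (nat \<Rightarrow> nat \<Rightarrow> real) \<Rightarrow> real \<Rightarrow> bool" where
  "op_bound d M r \<longleftrightarrow> 0 \<le> r \<and> (\<forall>x. dot d (mv d M x) (mv d M x) \<le> r\<^sup>2 * dot d x x)"

definition unit_vec :: "nat \<Rightarrow> nat \<Rightarrow> real" where
  "unit_vec j = (\<lambda>i. if i = j then 1 else 0)"

lemma quad_dot: "quad d M x = dot d x (mv d M x)"
  by (simp add: quad_def dot_def mv_def sum_distrib_left mult.assoc)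

lemma dot_self_nonneg: "0 \<le> dot d x x"
  by (simp add: dot_def sum_nonneg)

lemma dot_self_eq_0_iff: "dot d x x = 0 \<longleftrightarrow> (\<forall>i<d. x i = 0)"
  by (auto simp: dot_def sum_nonneg_eq_0_iff)

lemma dot_commute: "dot d x y = dot d y x"
  by (simp add: dot_def mult.commute)

lemma dot_cong: "(\<And>i. i < d \<Longrightarrow> x i = x' i) \<Longrightarrow> (\<And>i. i < d \<Longrightarrow> y i = y' i) \<Longrightarrow> dot d x y = dot d x' y'"
  by (simp add: dot_def)

lemma mv_cong: "(\<And>i. i < d \<Longrightarrow> x i = x' i) \<Longrightarrow> mv d M x = mv d M x'"
  by (simp add: mv_def)

lemma dot_linear:
  "dot d (\<lambda>i. x i + y i) z = dot d x z + dot d y z"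
  "dot d (\<lambda>i. x i - y i) z = dot d x z - dot d y z"
  "dot d (\<lambda>i. c * x i) z = c * dot d x z"
  "dot d z (\<lambda>i. x i + y i) = dot d z x + dot d z y"
  "dot d z (\<lambda>i. x i - y i) = dot d z x - dot d z y"
  "dot d z (\<lambda>i. c * x i) = c * dot d z x"
  by (simp_all add: dot_def algebra_simps sum.distrib sum_subtractf sum_distrib_left)

lemma mv_linear:
  "mv d M (\<lambda>i. x i + y i) = (\<lambda>i. mv d M x i + mv d M y i)"
  "mv d M (\<lambda>i. x i - y i) = (\<lambda>i. mv d M x i - mv d M y i)"
  "mv d M (\<lambda>i. c * x i) = (\<lambda>i. c * mv d M x i)"
  by (simp_all add: mv_def fun_eq_iff algebra_simps sum.distrib sum_subtractf sum_distrib_left)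

lemma mv_mat_mult: "i < d \<Longrightarrow> mv d (mat_mult d M N) x i = mv d M (mv d N x) i"
  unfolding mv_def mat_mult_def
  by (simp add: sum_distrib_left sum_distrib_right mult.assoc) (rule sum.swap)

lemma mv_mat_id: "i < d \<Longrightarrow> mv d (mat_id d) x i = x i"
  by (simp add: mv_def mat_id_def if_distrib [of "\<lambda>a. a * _"] cong: if_cong)

lemma dot_unit_vec: "j < d \<Longrightarrow> dot d (unit_vec j) x = x j"
  by (simp add: dot_def unit_vec_def if_distrib [of "\<lambda>a. a * _"] cong: if_cong)

lemma mv_unit_vec: "j < d \<Longrightarrow> mv d M (unit_vec j) i = M i j"
  by (simp add: mv_def unit_vec_def if_distrib [of "\<lambda>a. _ * a"] cong: if_cong)

lemma dot_mv_symmetric: "symmetric_mat d M \<Longrightarrow> dot d (mv d M x) y = dot d x (mv d M y)"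
proof -
  assume s: "symmetric_mat d M"
  have "dot d (mv d M x) y = (\<Sum>i<d. \<Sum>j<d. M i j * x j * y i)"
    by (simp add: dot_def mv_def sum_distrib_right)
  also have "\<dots> = (\<Sum>j<d. \<Sum>i<d. M i j * x j * y i)" by (rule sum.swap)
  also have "\<dots> = (\<Sum>j<d. \<Sum>i<d. x j * (M j i * y i))"
    using s by (intro sum.cong refl) (auto simp: symmetric_mat_def)
  finally show ?thesis by (simp add: dot_def mv_def sum_distrib_left)
qed

lemma dot_cauchy_schwarz: "(dot d x y)\<^sup>2 \<le> dot d x x * dot d y y"
  using Cauchy_Schwarz_ineq_sum[of x y "{..<d}"] by (simp add: dot_def power2_eq_square)

lemma dot_diff_self_le: "dot d (\<lambda>i. x i - y i) (\<lambda>i. x i - y i) \<le> 2 * dot d x x + 2 * dot d y y"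
proof -
  have "(a - b) * (a - b) \<le> 2 * (a * a) + 2 * (b * b)" for a b :: real
    using sum_squares_ge_zero[of "a + b" 0] by (simp add: algebra_simps)
  then show ?thesis
    unfolding dot_def sum_distrib_left sum.distrib[symmetric] by (intro sum_mono)
qed

text \<open>Polarization bounds \<open>\<langle>y, M x\<rangle>\<close>, here with \<open>y\<close> a multiple of \<open>M x\<close>.\<close>

lemma op_bound_symmetric:
  assumes s: "symmetric_mat d M" and r: "0 \<le> r" and q: "\<And>x. \<bar>quad d M x\<bar> \<le> r * dot d x x"
  shows "op_bound d M r"
  unfolding op_bound_def
proof (intro conjI allI r)
  fix x
  define y where "y = mv d M x"
  define a where "a = dot d x x"
  define b where "b = dot d y y"
  have key: "2 * t * b \<le> r * (a + t\<^sup>2 * b)" for t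
  proof -
    define u v where "u = (\<lambda>i. x i + t * y i)" and "v = (\<lambda>i. x i - t * y i)"
    have "quad d M u - quad d M v = 4 * t * b"
      using dot_mv_symmetric[OF s, of x y]
      by (simp add: u_def v_def quad_dot mv_linear dot_linear b_def y_def[symmetric] algebra_simps)
    moreover have "dot d u u + dot d v v = 2 * (a + t\<^sup>2 * b)"
      by (simp add: u_def v_def dot_linear a_def b_def dot_commute[of d y x] power2_eq_square algebra_simps)
    then have "r * dot d u u + r * dot d v v = r * (2 * (a + t\<^sup>2 * b))"
      by (metis distrib_left)
    ultimately show ?thesis
      using abs_le_D1[OF q[of u]] abs_le_D2[OF q[of v]] by linarith
  qed
  \<comment> \<open>For r = 0 the choice t = 1 already forces b \<le> 0. Otherwise t = 1/r balances
    the two terms: 2 b / r \<le> r a + b / r.\<close>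
  have "b \<le> r\<^sup>2 * a"
  proof (cases "r = 0")
    case True
    with key[of 1] show ?thesis by simp
  next
    case False
    with r have "r > 0" by simp
    have "r * (2 * (1 / r) * b) \<le> r * (r * (a + (1 / r)\<^sup>2 * b))"
      using key[of "1 / r"] r by (intro mult_left_mono)
    then show ?thesis using \<open>r > 0\<close> by (simp add: power2_eq_square distrib_left)
  qed
  then show "dot d (mv d M x) (mv d M x) \<le> r\<^sup>2 * dot d x x"
    by (simp add: a_def b_def y_def)
qed

lemma op_boundD: "op_bound d M r \<Longrightarrow> dot d (mv d M x) (mv d M x) \<le> r\<^sup>2 * dot d x x"
  by (simp add: op_bound_def)

lemma op_bound_nonneg: "op_bound d M r \<Longrightarrow> 0 \<le> r"
  by (simp add: op_bound_def)

lemma op_bound_mat_mult: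
  assumes "op_bound d M r" "op_bound d N s" shows "op_bound d (mat_mult d M N) (r * s)"
  unfolding op_bound_def
proof (intro conjI allI)
  show "0 \<le> r * s" using assms by (simp add: op_bound_nonneg)
  fix x
  have "dot d (mv d (mat_mult d M N) x) (mv d (mat_mult d M N) x)
      = dot d (mv d M (mv d N x)) (mv d M (mv d N x))"
    by (intro dot_cong) (simp_all add: mv_mat_mult)
  also have "\<dots> \<le> r\<^sup>2 * dot d (mv d N x) (mv d N x)" by (rule op_boundD[OF assms(1)])
  also have "\<dots> \<le> r\<^sup>2 * (s\<^sup>2 * dot d x x)" by (intro mult_left_mono op_boundD[OF assms(2)]) simp
  finally show "dot d (mv d (mat_mult d M N) x) (mv d (mat_mult d M N) x) \<le> (r * s)\<^sup>2 * dot d x x"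
    by (simp add: power_mult_distrib mult.assoc)
qed

lemma op_bound_mat_id: "op_bound d (mat_id d) 1"
  unfolding op_bound_def by (auto intro!: eq_refl dot_cong simp: mv_mat_id)

lemma op_bound_mpow: "op_bound d M r \<Longrightarrow> op_bound d (mpow d M k) (r ^ k)"
  by (induction k) (auto intro: op_bound_mat_id op_bound_mat_mult)

text \<open>The columns are the images of the \<open>d\<close> unit vectors, each of squared length
  at most r^2. This is how an operator bound becomes a Frobenius bound, at the price of one factor
  \<open>d\<close>.\<close>

lemma op_bound_sum_squares:
  assumes "op_bound d M r" shows "(\<Sum>i<d. \<Sum>j<d. (M i j)\<^sup>2) \<le> real d * r\<^sup>2"
proof -
  have "(\<Sum>i<d. \<Sum>j<d. (M i j)\<^sup>2) = (\<Sum>j<d. \<Sum>i<d. (M i j)\<^sup>2)" by (rule sum.swap)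
  also have "\<dots> = (\<Sum>j<d. dot d (mv d M (unit_vec j)) (mv d M (unit_vec j)))"
    by (simp add: dot_def mv_unit_vec power2_eq_square)
  also have "\<dots> \<le> (\<Sum>j<d. r\<^sup>2 * dot d (unit_vec j) (unit_vec j))"
    by (intro sum_mono op_boundD assms)
  also have "\<dots> = (\<Sum>j<d. r\<^sup>2)" by (simp add: dot_unit_vec) (simp add: unit_vec_def)
  finally show ?thesis by simp
qed

lemma op_bound_entry:
  assumes "op_bound d M r" "i < d" "j < d" shows "\<bar>M i j\<bar> \<le> r"
proof -
  have "(M i j)\<^sup>2 \<le> (\<Sum>i<d. (M i j)\<^sup>2)"
    using assms by (intro member_le_sum) auto
  also have "\<dots> = dot d (mv d M (unit_vec j)) (mv d M (unit_vec j))"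
    using assms by (simp add: dot_def mv_unit_vec power2_eq_square)
  also have "\<dots> \<le> r\<^sup>2 * dot d (unit_vec j) (unit_vec j)" by (rule op_boundD[OF assms(1)])
  also have "\<dots> = r\<^sup>2" using assms by (simp add: dot_unit_vec) (simp add: unit_vec_def)
  finally show ?thesis using op_bound_nonneg[OF assms(1)] using power2_le_imp_le[of "\<bar>M i j\<bar>" r] by simp
qed

lemma dmat_mat_mult [simp]: "dmat d (mat_mult d M N)"
  by (auto simp: dmat_def mat_mult_def)

lemma dmat_mat_id [simp]: "dmat d (mat_id d)"
  by (auto simp: dmat_def mat_id_def)

lemma dmat_mpow [simp]: "dmat d (mpow d M k)"
  by (cases k) auto

lemma dmat_eqI:
  "dmat d M \<Longrightarrow> dmat d N \<Longrightarrow> (\<And>i j. i < d \<Longrightarrow> j < d \<Longrightarrow> M i j = N i j) \<Longrightarrow> M = N"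
  by (intro ext, rename_tac i j, case_tac "i < d \<and> j < d") (auto simp: dmat_def not_less)

lemma mat_mult_assoc: "mat_mult d (mat_mult d L M) N = mat_mult d L (mat_mult d M N)"
proof -
  have "(\<Sum>k<d. (\<Sum>l<d. L i l * M l k) * N k j) = (\<Sum>l<d. L i l * (\<Sum>k<d. M l k * N k j))" for i j
    by (simp add: sum_distrib_left sum_distrib_right mult.assoc) (rule sum.swap)
  then show ?thesis by (auto simp: mat_mult_def fun_eq_iff)
qed

lemma mat_mult_id_left: "dmat d M \<Longrightarrow> mat_mult d (mat_id d) M = M"
  by (rule dmat_eqI[of d], simp, simp) (auto simp: mat_mult_def mat_id_def if_distrib [of "\<lambda>a. a * _"] cong: if_cong)

lemma mat_mult_id_right: "dmat d M \<Longrightarrow> mat_mult d M (mat_id d) = M"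
  by (rule dmat_eqI[of d], simp, simp) (auto simp: mat_mult_def mat_id_def if_distrib [of "\<lambda>a. _ * a"] cong: if_cong)

lemma mat_mult_cong:
  "(\<And>i j. i < d \<Longrightarrow> j < d \<Longrightarrow> M i j = M' i j) \<Longrightarrow> (\<And>i j. i < d \<Longrightarrow> j < d \<Longrightarrow> N i j = N' i j)
    \<Longrightarrow> mat_mult d M N = mat_mult d M' N'"
  by (auto simp: mat_mult_def fun_eq_iff)

lemma mat_mult_scale: "mat_mult d (\<lambda>i j. a * M i j) (\<lambda>i j. b * N i j) = (\<lambda>i j. a * b * mat_mult d M N i j)"
  by (auto simp: mat_mult_def fun_eq_iff sum_distrib_left mult_ac)

lemma mpow_add: "mat_mult d (mpow d M j) (mpow d M k) = mpow d M (j + k)"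
  by (induction j) (auto simp: mat_mult_id_left mat_mult_assoc)

lemma symmetric_mat_id: "symmetric_mat d (mat_id d)"
  by (auto simp: symmetric_mat_def mat_id_def)

text \<open>Transposition reverses M M^k into M^k M, and \<open>mpow_add\<close> shows that powers
  of one matrix commute.\<close>

lemma symmetric_mpow: "symmetric_mat d M \<Longrightarrow> symmetric_mat d (mpow d M k)"
proof (induction k)
  case (Suc k)
  have "mpow d M (Suc k) i j = mpow d M (Suc k) j i" if "i < d" "j < d" for i j
  proof -
    \<comment> \<open>\<open>M\<close> may have nonzero entries beyond \<open>d\<close>, whereas its
      powers vanish there, so the two agree only on indices below \<open>d\<close>.\<close>
    have 1: "mpow d M (Suc 0) i j = M i j" if "i < d" "j < d" for i j
      using that by (simp add: mat_mult_def mat_id_def if_distrib [of "\<lambda>a. _ * a"] cong: if_cong)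
    have "mpow d M (Suc k) i j = mat_mult d M (mpow d M k) i j" by simp
    also have "\<dots> = mat_mult d (mpow d M k) (mpow d M 1) j i"
      using Suc that 1 by (auto simp: mat_mult_def symmetric_mat_def mult.commute simp del: mpow.simps)
    also have "\<dots> = mpow d M (Suc k) j i" by (subst mpow_add) simp
    finally show ?thesis .
  qed
  then show ?case by (simp add: symmetric_mat_def)
qed (simp add: symmetric_mat_id)

lemma mat_inverse_eq:
  assumes "dmat d N" "mat_mult d M N = mat_id d" "mat_mult d N M = mat_id d"
  shows "mat_inverse d M = N"
  unfolding mat_inverse_def
proof (rule the_equality)
  fix N' assume N': "dmat d N' \<and> mat_mult d M N' = mat_id d \<and> mat_mult d N' M = mat_id d"
  have "N' = mat_mult d (mat_mult d N M) N'" using N' assms by (simp add: mat_mult_id_left)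
  also have "\<dots> = mat_mult d N (mat_mult d M N')" by (rule mat_mult_assoc)
  also have "\<dots> = N" using N' assms by (simp add: mat_mult_id_right)
  finally show "N' = N" .
qed (use assms in auto)

section \<open>Uniqueness of positive semidefinite square roots\<close>

definition trace_mat :: "nat \<Rightarrow> (nat \<Rightarrow> nat \<Rightarrow> real) \<Rightarrow> real" where
  "trace_mat d M = (\<Sum>i<d. M i i)"

lemma trace_mat_mult_commute: "trace_mat d (mat_mult d M N) = trace_mat d (mat_mult d N M)"
  by (simp add: trace_mat_def mat_mult_def) (subst sum.swap, simp add: mult.commute)

text \<open>A nonnegative form that vanishes at \<open>y\<close> has a minimum there, so its
  gradient 2 S y is zero: otherwise a small step from \<open>y\<close> against S y would make the
  form negative.\<close>

lemma psd_quad_eq_0: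
  assumes "psd d S" "quad d S y = 0" "i < d" shows "mv d S y i = 0"
proof -
  define z where "z = mv d S y"
  define a where "a = dot d z z"
  define b where "b = quad d S z"
  have s: "symmetric_mat d S" using assms(1) by (simp add: psd_def)
  have ge: "0 \<le> 2 * t * a + t\<^sup>2 * b" for t
  proof -
    have "0 \<le> quad d S (\<lambda>i. y i + t * z i)" using assms(1) by (simp add: psd_def)
    also have "\<dots> = 2 * t * a + t\<^sup>2 * b"
      using assms(2) dot_mv_symmetric[OF s, of y z]
      by (simp add: quad_dot mv_linear dot_linear a_def b_def z_def[symmetric] power2_eq_square algebra_simps)
    finally show ?thesis .
  qed
  have "b \<ge> 0" using assms(1) by (simp add: psd_def b_def)
  have "a \<ge> 0" by (simp add: a_def dot_self_nonneg)
  \<comment> \<open>The step -q along S y minimizes 2 t a + t^2 b up to a constant; b + 1 in place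
    of b keeps the quotient meaningful when b = 0.\<close>
  define q where "q = a / (b + 1)"
  have aq: "a = q * (b + 1)" using \<open>b \<ge> 0\<close> by (simp add: q_def)
  have "0 \<le> 2 * (- q) * a + (- q)\<^sup>2 * b" by (rule ge)
  also have "\<dots> = q\<^sup>2 * (- b - 2)"
    by (simp add: aq power2_eq_square algebra_simps)
  finally have "q = 0"
    using \<open>b \<ge> 0\<close> by (simp add: zero_le_mult_iff)
  then have "a = 0" by (simp add: aq)
  then show ?thesis using assms(3) by (simp add: a_def dot_self_eq_0_iff z_def)
qed

text \<open>The j-th diagonal entry of D S D is the form of \<open>S\<close> evaluated at the j-th
  column of the symmetric matrix \<open>D\<close>. Thus a vanishing trace becomes a vanishing sum of
  nonnegative terms when \<open>S\<close> is positive semidefinite.\<close>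

lemma trace_conj:
  assumes "symmetric_mat d D"
  shows "trace_mat d (mat_mult d D (mat_mult d S D)) = (\<Sum>j<d. quad d S (mv d D (unit_vec j)))"
  using assms unfolding trace_mat_def quad_dot dot_def mv_def[of d S]
  by (intro sum.cong refl) (simp add: mat_mult_def mv_unit_vec, simp add: symmetric_mat_def)

text \<open>For \<open>D = S - T\<close> one has \<open>S D + D T = 0\<close>, so \<open>tr (D S D) + tr (D T D) = 0\<close> by cyclicity.\<close>

lemma psd_sqrt_unique:
  assumes "psd d S" "psd d T" and eq: "mat_mult d S S = mat_mult d T T" and ij: "i < d" "j < d"
  shows "S i j = T i j"
proof -
  define D where "D = (\<lambda>i j. S i j - T i j)"
  have symS: "symmetric_mat d S" and symT: "symmetric_mat d T" using assms by (auto simp: psd_def)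
  have symD: "symmetric_mat d D" using symS symT by (simp add: symmetric_mat_def D_def)
  have mvD: "mv d D z k = mv d S z k - mv d T z k" for z k
    by (simp add: mv_def D_def left_diff_distrib sum_subtractf)
  have "mat_mult d S D i j + mat_mult d D T i j = mat_mult d S S i j - mat_mult d T T i j" for i j
    by (simp add: mat_mult_def D_def algebra_simps sum_subtractf)
  then have *: "mat_mult d S D = (\<lambda>i j. (-1) * mat_mult d D T i j)"
    using eq by (simp add: fun_eq_iff add_eq_0_iff2)
  have "trace_mat d (mat_mult d D (mat_mult d S D)) = - trace_mat d (mat_mult d D (mat_mult d D T))"
    unfolding * by (simp add: trace_mat_def mat_mult_def sum_negf)
  also have "trace_mat d (mat_mult d D (mat_mult d D T)) = trace_mat d (mat_mult d D (mat_mult d T D))"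
    by (subst (2) mat_mult_assoc[symmetric], subst (2) trace_mat_mult_commute) simp
  finally have "(\<Sum>j<d. quad d S (mv d D (unit_vec j)) + quad d T (mv d D (unit_vec j))) = 0"
    by (simp add: trace_conj[OF symD] sum.distrib)
  moreover have "0 \<le> quad d S x" "0 \<le> quad d T x" for x using assms by (auto simp: psd_def)
  ultimately have "quad d S (mv d D (unit_vec j)) + quad d T (mv d D (unit_vec j)) = 0"
    using ij by (subst (asm) sum_nonneg_eq_0_iff) auto
  with \<open>\<And>x. 0 \<le> quad d S x\<close> \<open>\<And>x. 0 \<le> quad d T x\<close>
  have "quad d S (mv d D (unit_vec j)) = 0" "quad d T (mv d D (unit_vec j)) = 0"
    by (meson add_nonneg_eq_0_iff)+
  \<comment> \<open>Both \<open>S\<close> and \<open>T\<close> annihilate the column D e_j, hence so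
    does their difference \<open>D\<close>; symmetry turns D D e_j = 0 into |D e_j|^2 = 0.\<close>
  then have "mv d D (mv d D (unit_vec j)) k = 0" if "k < d" for k
    using psd_quad_eq_0[OF assms(1) _ that, of "mv d D (unit_vec j)"]
      psd_quad_eq_0[OF assms(2) _ that, of "mv d D (unit_vec j)"] mvD by simp
  then have "dot d (unit_vec j) (mv d D (mv d D (unit_vec j))) = 0" by (simp add: dot_def)
  then have "dot d (mv d D (unit_vec j)) (mv d D (unit_vec j)) = 0" by (simp add: dot_mv_symmetric[OF symD])
  then show ?thesis using ij by (simp add: dot_self_eq_0_iff mv_unit_vec D_def)
qed

lemma mat_sqrt_eq:
  assumes "dmat d S" "psd d S" "\<And>i j. i < d \<Longrightarrow> j < d \<Longrightarrow> mat_mult d S S i j = M i j"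
  shows "mat_sqrt d M = S"
  unfolding mat_sqrt_def
proof (rule the_equality)
  fix T assume T: "dmat d T \<and> psd d T \<and> (\<forall>i<d. \<forall>j<d. mat_mult d T T i j = M i j)"
  then have "mat_mult d T T = mat_mult d S S" using assms by (intro dmat_eqI[of d]) auto
  then show "T = S" using T assms by (intro dmat_eqI[of d]) (auto intro: psd_sqrt_unique)
qed (use assms in auto)

section \<open>Binomial series: existence of square roots and inverses\<close>

text \<open>All signed coefficients (-1)^k (a choose k) with k \<ge> 1 are nonpositive, so the sum
  of absolute values telescopes to 2 minus the signed partial sum, which stays nonnegative. Absolute
  convergence on the boundary of the unit disc is required because a singular semidefinite matrix
  leads to an N of norm exactly 1.\<close>

lemma summable_abs_gbinomial:
  fixes a :: real
  assumes "0 \<le> a" "a \<le> 1"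
  shows "summable (\<lambda>k. \<bar>a gchoose k\<bar>)"
proof (rule summableI_nonneg_bounded)
  \<comment> \<open>The signed partial sum in closed form; it is the product of the factors 1 - a/k
    for k = 1, ..., n, hence nonnegative and decreasing.\<close>
  define u where "u n = (- 1) ^ n * (a - 1 gchoose n)" for n
  have u_Suc: "u (Suc n) = u n * ((real n + 1 - a) / (real n + 1))" for n
    by (simp add: u_def gbinomial_prod_rev field_simps)
  have u_nonneg: "0 \<le> u n" for n
  proof (induction n)
    case (Suc n)
    then show ?case unfolding u_Suc using assms by (intro mult_nonneg_nonneg divide_nonneg_pos) auto
  qed (simp add: u_def)
  have u_sum: "u n = (\<Sum>k\<le>n. (a gchoose k) * (- 1) ^ k)" for n
    by (simp add: u_def gbinomial_sum_lower_neg)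
  have sum_eq: "(\<Sum>k\<le>n. \<bar>a gchoose k\<bar>) = 2 - u n" for n
  proof (induction n)
    case (Suc n)
    have "u (Suc n) \<le> u n * 1"
      unfolding u_Suc using assms by (intro mult_left_mono u_nonneg) simp
    moreover have "u (Suc n) - u n = (a gchoose Suc n) * (- 1) ^ Suc n"
      by (simp only: u_sum sum.atMost_Suc)
    moreover have "\<bar>(a gchoose Suc n) * (- 1) ^ Suc n\<bar> = \<bar>a gchoose Suc n\<bar>"
      by (simp add: abs_mult power_abs del: power_Suc)
    ultimately have "\<bar>a gchoose Suc n\<bar> = u n - u (Suc n)" by linarith
    with Suc show ?case by simp
  qed (simp add: u_def)
  show "(\<Sum>k<n. \<bar>a gchoose k\<bar>) \<le> 2" for n
    using sum_eq[of n] u_nonneg[of n] by (simp add: lessThan_Suc_atMost[symmetric])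
qed simp

text \<open>The binomial series of \<open>(I - N)\<^sup>a\<close>.\<close>

definition binom_series :: "nat \<Rightarrow> (nat \<Rightarrow> nat \<Rightarrow> real) \<Rightarrow> real \<Rightarrow> nat \<Rightarrow> nat \<Rightarrow> real" where
  "binom_series d N a = (\<lambda>i j. if i < d \<and> j < d then \<Sum>k. (a gchoose k) * (- 1) ^ k * mpow d N k i j else 0)"

lemma dmat_binom_series [simp]: "dmat d (binom_series d N a)"
  by (auto simp: dmat_def binom_series_def)

lemma summable_binom_series:
  assumes "op_bound d N r" "summable (\<lambda>k. \<bar>a gchoose k\<bar> * r ^ k)" "i < d" "j < d"
  shows "summable (\<lambda>k. norm ((a gchoose k) * (- 1) ^ k * mpow d N k i j))"
  using assms(2)
proof (rule summable_comparison_test'[where N = 0])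
  fix k :: nat
  have "\<bar>mpow d N k i j\<bar> \<le> r ^ k"
    by (rule op_bound_entry[OF op_bound_mpow[OF assms(1)] assms(3,4)])
  then show "norm (norm ((a gchoose k) * (- 1) ^ k * mpow d N k i j)) \<le> \<bar>a gchoose k\<bar> * r ^ k"
    by (simp add: abs_mult power_abs mult_left_mono)
qed

text \<open>In the Cauchy product the coefficient of N^n is the sum of (a choose k) (b choose n -
  k), which is (a + b choose n) by Vandermonde. The additivity of exponents is what makes the series
  a square root for 1/2 + 1/2 = 1 and an inverse for 1 + (-1) = 0.\<close>

lemma binom_series_mult:
  assumes N: "op_bound d N r"
    and a: "summable (\<lambda>k. \<bar>a gchoose k\<bar> * r ^ k)" and b: "summable (\<lambda>k. \<bar>b gchoose k\<bar> * r ^ k)"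
  shows "mat_mult d (binom_series d N a) (binom_series d N b) = binom_series d N (a + b)"
proof (rule dmat_eqI[of d])
  fix i j assume ij: "i < d" "j < d"
  define f where "f l k = (a gchoose k) * (- 1) ^ k * mpow d N k i l" for l k
  define g where "g l k = (b gchoose k) * (- 1) ^ k * mpow d N k l j" for l k
  define h where "h n = (a + b gchoose n) * (- 1) ^ n * mpow d N n i j" for n
  have "(\<lambda>n. \<Sum>l<d. \<Sum>k\<le>n. f l k * g l (n - k)) sums (\<Sum>l<d. suminf (f l) * suminf (g l))"
    using ij unfolding f_def g_def
    by (intro sums_sum Cauchy_product_sums summable_binom_series[OF N] a b) auto
  moreover have "(\<Sum>l<d. \<Sum>k\<le>n. f l k * g l (n - k)) = h n" for n
  proof -
    have "(\<Sum>l<d. \<Sum>k\<le>n. f l k * g l (n - k)) = (\<Sum>k\<le>n. \<Sum>l<d. f l k * g l (n - k))"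
      by (rule sum.swap)
    also have "\<dots> = (\<Sum>k\<le>n. (a gchoose k) * (b gchoose (n - k)) * ((- 1) ^ n * mpow d N n i j))"
    proof (rule sum.cong[OF refl])
      fix k assume k: "k \<in> {..n}"
      have "(\<Sum>l<d. mpow d N k i l * mpow d N (n - k) l j) = mpow d N n i j"
        using ij k mpow_add[of d N k "n - k"] by (simp add: mat_mult_def fun_eq_iff) metis
      moreover have "(\<Sum>l<d. f l k * g l (n - k)) = (a gchoose k) * (b gchoose (n - k)) *
          ((- 1) ^ k * (- 1) ^ (n - k) * (\<Sum>l<d. mpow d N k i l * mpow d N (n - k) l j))"
        by (simp add: f_def g_def sum_distrib_left mult_ac)
      moreover have "(- 1) ^ k * (- 1) ^ (n - k) = ((- 1) ^ n :: real)"
        using k by (simp flip: power_add)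
      ultimately show "(\<Sum>l<d. f l k * g l (n - k))
          = (a gchoose k) * (b gchoose (n - k)) * ((- 1) ^ n * mpow d N n i j)" by simp
    qed
    also have "\<dots> = (\<Sum>k=0..n. (a gchoose k) * (b gchoose (n - k))) * ((- 1) ^ n * mpow d N n i j)"
      by (simp add: sum_distrib_right atLeast0AtMost)
    also have "\<dots> = h n" by (simp add: h_def gbinomial_Vandermonde)
    finally show ?thesis .
  qed
  ultimately have "h sums (\<Sum>l<d. suminf (f l) * suminf (g l))" by simp
  then have "suminf h = (\<Sum>l<d. suminf (f l) * suminf (g l))" by (simp add: sums_iff)
  then show "mat_mult d (binom_series d N a) (binom_series d N b) i j = binom_series d N (a + b) i j"
    using ij by (simp add: mat_mult_def binom_series_def f_def[abs_def] g_def[abs_def] h_def[abs_def])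
qed auto

lemma binom_series_0: "binom_series d N 0 = mat_id d"
proof (rule dmat_eqI[of d])
  fix i j assume "i < d" "j < d"
  have "(\<Sum>k. (0 gchoose k) * (- 1) ^ k * mpow d N k i j) = (\<Sum>k\<in>{0}. (0 gchoose k) * (- 1) ^ k * mpow d N k i j)"
    by (rule suminf_finite) (auto simp: gbinomial_0_left)
  with \<open>i < d\<close> \<open>j < d\<close> show "binom_series d N 0 i j = mat_id d i j" by (simp add: binom_series_def)
qed auto

lemma gbinomial_1_left_eq_0: "0 < k \<Longrightarrow> k \<noteq> Suc 0 \<Longrightarrow> (1 gchoose k :: real) = 0"
  using binomial_gbinomial[of 1 k, where 'a=real] by (simp add: binomial_eq_0)

lemma mpow_1: "i < d \<Longrightarrow> j < d \<Longrightarrow> mpow d N (Suc 0) i j = N i j"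
  by (simp add: mat_mult_def mat_id_def if_distrib [of "\<lambda>a. _ * a"] cong: if_cong)

lemma binom_series_1:
  assumes "i < d" "j < d" shows "binom_series d N 1 i j = mat_id d i j - N i j"
proof -
  have "(\<Sum>k. (1 gchoose k) * (- 1) ^ k * mpow d N k i j)
      = (\<Sum>k\<in>{0, Suc 0}. (1 gchoose k) * (- 1) ^ k * mpow d N k i j)"
    by (intro suminf_finite) (auto simp: gbinomial_1_left_eq_0)
  with assms show ?thesis
    using mpow_1[OF assms] by (simp add: binom_series_def del: mpow.simps(2))
qed

lemma symmetric_binom_series:
  assumes "symmetric_mat d N" shows "symmetric_mat d (binom_series d N a)"
  using symmetric_mpow[OF assms] by (auto simp: symmetric_mat_def binom_series_def)

lemma quad_scale_id: "quad d (scal_id d c) x = c * dot d x x"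
proof -
  have "mv d (scal_id d c) x i = c * x i" if "i < d" for i
    using mv_mat_id[OF that, of x] by (simp add: scal_id_def mv_def mult.assoc flip: sum_distrib_left)
  then show ?thesis
    unfolding quad_dot by (subst dot_cong[where x' = x and y' = "\<lambda>i. c * x i"]) (auto simp: dot_linear)
qed

lemma mv_id_minus_scale:
  assumes "i < d" shows "mv d (\<lambda>i j. mat_id d i j - c * M i j) x i = x i - c * mv d M x i"
  using mv_mat_id[OF assms, of x]
  by (simp add: mv_def left_diff_distrib sum_subtractf sum_distrib_left mult.assoc)

lemma quad_id_minus_scale:
  "quad d (\<lambda>i j. mat_id d i j - c * M i j) x = dot d x x - c * quad d M x"
proof -
  have "quad d (\<lambda>i j. mat_id d i j - c * M i j) x = dot d x (\<lambda>i. x i - c * mv d M x i)"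
    unfolding quad_dot by (intro dot_cong) (simp_all add: mv_id_minus_scale)
  then show ?thesis by (simp add: dot_linear quad_dot)
qed

lemma symmetric_id_minus_scale:
  "symmetric_mat d M \<Longrightarrow> symmetric_mat d (\<lambda>i j. mat_id d i j - c * M i j)"
  using symmetric_mat_id[of d] by (auto simp: symmetric_mat_def)

text \<open>A crude bound suffices: it only provides a scale \<open>c\<close> for which I - M/c has
  norm at most 1.\<close>

lemma quad_le_sum_abs: "quad d M x \<le> (\<Sum>i<d. \<Sum>j<d. \<bar>M i j\<bar>) * dot d x x"
proof -
  have "x i * M i j * x j \<le> \<bar>M i j\<bar> * dot d x x" if "i < d" "j < d" for i j
  proof -
    have "\<bar>x i * x j\<bar> \<le> dot d x x"
    proof -
      have "\<bar>x k\<bar> \<le> sqrt (dot d x x)" if "k < d" for k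
        using that member_le_sum[of k "{..<d}" "\<lambda>i. x i * x i"]
        by (intro real_le_rsqrt) (simp add: dot_def power2_eq_square)
      then have "\<bar>x i\<bar> * \<bar>x j\<bar> \<le> sqrt (dot d x x) * sqrt (dot d x x)"
        using that by (intro mult_mono) (auto simp: dot_self_nonneg)
      then show ?thesis by (simp add: abs_mult dot_self_nonneg)
    qed
    then have "\<bar>M i j\<bar> * \<bar>x i * x j\<bar> \<le> \<bar>M i j\<bar> * dot d x x" by (simp add: mult_left_mono)
    then show ?thesis by (simp add: abs_mult[symmetric] mult_ac abs_le_iff)
  qed
  then show ?thesis unfolding quad_def sum_distrib_right by (intro sum_mono) auto
qed

text \<open>With M = c (I - N) and 0 \<le> M \<le> c I, the form of \<open>N\<close> lies between 0
  and |x|^2, so (I - N)^(1/2) converges as a binomial series and the square root of \<open>M\<close>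
  is sqrt c times it.\<close>

lemma psd_sqrt_exists:
  assumes M: "psd d M"
  obtains S where "dmat d S" "psd d S" "\<And>i j. i < d \<Longrightarrow> j < d \<Longrightarrow> mat_mult d S S i j = M i j"
proof -
  \<comment> \<open>The summand 1 keeps c > 0 for M = 0 and for d = 0.\<close>
  define c where "c = 1 + (\<Sum>i<d. \<Sum>j<d. \<bar>M i j\<bar>)"
  have c: "c > 0" by (simp add: c_def add_pos_nonneg sum_nonneg)
  define N where "N = (\<lambda>i j. mat_id d i j - (1 / c) * M i j)"
  have symN: "symmetric_mat d N"
    unfolding N_def by (rule symmetric_id_minus_scale) (use M in \<open>simp add: psd_def\<close>)
  have N: "op_bound d N 1"
  proof (rule op_bound_symmetric[OF symN])
    fix x
    have q: "quad d N x = dot d x x - (1 / c) * quad d M x"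
      unfolding N_def by (rule quad_id_minus_scale)
    have "quad d M x \<le> c * dot d x x"
      using quad_le_sum_abs[of d M x] dot_self_nonneg[of d x] by (simp add: c_def algebra_simps)
    then have "(1 / c) * quad d M x \<le> dot d x x" using c by (simp add: field_simps)
    moreover have "0 \<le> (1 / c) * quad d M x" using M c by (simp add: psd_def)
    ultimately show "\<bar>quad d N x\<bar> \<le> 1 * dot d x x" unfolding q by simp
  qed simp
  have mult: "mat_mult d (binom_series d N a) (binom_series d N b) = binom_series d N (a + b)"
    if "0 \<le> a" "a \<le> 1" "0 \<le> b" "b \<le> 1" for a b
    using that summable_abs_gbinomial by (intro binom_series_mult[OF N]) auto
  \<comment> \<open>The series does not display its sign. The quarter power \<open>R\<close> is
    symmetric and squares to (I - N)^(1/2), whose form is therefore |R x|^2.\<close>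
  define R where "R = binom_series d N (1 / 4)"
  define S where "S = (\<lambda>i j. sqrt c * binom_series d N (1 / 2) i j)"
  have R: "symmetric_mat d R" unfolding R_def by (rule symmetric_binom_series[OF symN])
  have RR: "mat_mult d R R = binom_series d N (1 / 2)" unfolding R_def by (subst mult) auto
  show thesis
  proof
    show "dmat d S" using dmat_binom_series[of d N "1/2"] by (simp add: S_def dmat_def)
    have "quad d S x = sqrt c * dot d (mv d R x) (mv d R x)" for x
    proof -
      have "quad d S x = sqrt c * quad d (mat_mult d R R) x"
        by (simp add: quad_def S_def RR sum_distrib_left mult_ac)
      also have "quad d (mat_mult d R R) x = dot d x (mv d R (mv d R x))"
        unfolding quad_dot by (intro dot_cong) (auto simp: mv_mat_mult)
      finally show ?thesis by (simp add: dot_mv_symmetric[OF R])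
    qed
    then show "psd d S"
      using symmetric_binom_series[OF symN, of "1/2"] c
      by (auto simp: psd_def symmetric_mat_def S_def dot_self_nonneg)
    show "mat_mult d S S i j = M i j" if "i < d" "j < d" for i j
    proof -
      have "mat_mult d S S i j = c * binom_series d N 1 i j"
        using c mult[of "1/2" "1/2"] by (simp add: S_def mat_mult_scale)
      also have "\<dots> = M i j" using that c by (simp add: binom_series_1 N_def)
      finally show ?thesis .
    qed
  qed
qed

lemma psd_mat_sqrt:
  assumes "psd d M"
  shows "psd d (mat_sqrt d M)" "i < d \<Longrightarrow> j < d \<Longrightarrow> mat_mult d (mat_sqrt d M) (mat_sqrt d M) i j = M i j"
  using psd_sqrt_exists[OF assms] mat_sqrt_eq by metis+

lemma quad_mat_sqrt:
  assumes "psd d M"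
  shows "dot d (mv d (mat_sqrt d M) x) (mv d (mat_sqrt d M) x) = quad d M x"
proof -
  have s: "symmetric_mat d (mat_sqrt d M)" using psd_mat_sqrt(1)[OF assms] by (simp add: psd_def)
  have "dot d (mv d (mat_sqrt d M) x) (mv d (mat_sqrt d M) x)
      = dot d x (mv d (mat_sqrt d M) (mv d (mat_sqrt d M) x))"
    by (rule dot_mv_symmetric[OF s])
  also have "\<dots> = quad d (mat_mult d (mat_sqrt d M) (mat_sqrt d M)) x"
    unfolding quad_dot by (intro dot_cong) (auto simp: mv_mat_mult)
  also have "\<dots> = quad d M x" by (simp add: quad_def psd_mat_sqrt(2)[OF assms])
  finally show ?thesis .
qed

lemma quad_op_bound: "op_bound d M r \<Longrightarrow> \<bar>quad d M x\<bar> \<le> r * dot d x x"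
proof -
  assume M: "op_bound d M r"
  have "(quad d M x)\<^sup>2 \<le> dot d x x * dot d (mv d M x) (mv d M x)"
    unfolding quad_dot by (rule dot_cauchy_schwarz)
  also have "\<dots> \<le> dot d x x * (r\<^sup>2 * dot d x x)" by (intro mult_left_mono op_boundD[OF M] dot_self_nonneg)
  finally have "\<bar>quad d M x\<bar>\<^sup>2 \<le> (r * dot d x x)\<^sup>2" by (simp add: power2_eq_square mult_ac)
  then show ?thesis
    by (rule power2_le_imp_le) (simp add: op_bound_nonneg[OF M] dot_self_nonneg)
qed

text \<open>Since \<open>S - I = (T - I) (T + I)\<close> for \<open>S = T\<^sup>2\<close> and \<open>T + I \<ge> I\<close>, passing to the square root does not
  increase the Frobenius distance to \<open>I\<close>.\<close>

lemma mat_sqrt_id_frobenius: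
  assumes S: "psd d S" and e: "0 \<le> e" "\<And>x. \<bar>quad d S x - dot d x x\<bar> \<le> e * dot d x x"
  shows "(\<Sum>i<d. \<Sum>j<d. (mat_sqrt d S i j - mat_id d i j)\<^sup>2) \<le> real d * e\<^sup>2"
proof -
  define T where "T = mat_sqrt d S"
  have T: "psd d T" "\<And>i j. i < d \<Longrightarrow> j < d \<Longrightarrow> mat_mult d T T i j = S i j"
    using psd_mat_sqrt[OF S] by (auto simp: T_def)
  have symT: "symmetric_mat d T" using T by (simp add: psd_def)
  define E where "E = (\<lambda>i j. S i j - mat_id d i j)"
  define F where "F = (\<lambda>i j. T i j - mat_id d i j)"
  have symE: "symmetric_mat d E"
    using S symmetric_mat_id[of d] by (simp add: psd_def symmetric_mat_def E_def)
  have "op_bound d E e"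
  proof (rule op_bound_symmetric[OF symE e(1)])
    fix x
    have "mv d E x i = mv d S x i - x i" if "i < d" for i
      using mv_mat_id[OF that, of x] by (simp add: mv_def E_def left_diff_distrib sum_subtractf)
    then have "quad d E x = dot d x (\<lambda>i. mv d S x i - x i)"
      unfolding quad_dot by (intro dot_cong) auto
    then have "quad d E x = quad d S x - dot d x x" by (simp add: dot_linear quad_dot)
    then show "\<bar>quad d E x\<bar> \<le> e * dot d x x" using e(2)[of x] by simp
  qed
  have "op_bound d F e"
    unfolding op_bound_def
  proof (intro conjI allI e(1))
    fix x
    define y where "y = mv d F x"
    \<comment> \<open>Here z = (T + I) (T - I) x = (S - I) x on indices below \<open>d\<close>.
      Since the form of \<open>T\<close> is nonnegative, |y|^2 \<le> <y, z>, and Cauchy-Schwarz then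
      gives |y| \<le> |z|.\<close>
    define z where "z = (\<lambda>i. mv d T y i + y i)"
    have Fi: "mv d F v i = mv d T v i - v i" if "i < d" for i v
      using mv_mat_id[OF that, of v] by (simp add: mv_def F_def left_diff_distrib sum_subtractf)
    have Ei: "mv d E v i = mv d S v i - v i" if "i < d" for i v
      using mv_mat_id[OF that, of v] by (simp add: mv_def E_def left_diff_distrib sum_subtractf)
    have TT: "mv d T (mv d T v) i = mv d S v i" if "i < d" for i v
      using that T(2) by (simp flip: mv_mat_mult) (simp add: mv_def)
    have zE: "z i = mv d E x i" if "i < d" for i
    proof -
      have "mv d T y = mv d T (\<lambda>i. mv d T x i - x i)"
        by (rule mv_cong) (simp add: y_def Fi)
      then show ?thesis using that by (simp add: z_def mv_linear TT Ei y_def Fi)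
    qed
    have "dot d y y \<le> dot d y z"
      using T(1) by (simp add: z_def dot_linear psd_def flip: quad_dot)
    then have "dot d y y * dot d y y \<le> dot d y z * dot d y z"
      by (intro mult_mono) (auto simp: dot_self_nonneg intro: order_trans[OF dot_self_nonneg])
    also have "\<dots> \<le> dot d y y * dot d z z"
      using dot_cauchy_schwarz[of d y z] by (simp add: power2_eq_square)
    finally have "dot d y y \<le> dot d z z"
      using dot_self_nonneg[of d y] dot_self_nonneg[of d z] by (cases "dot d y y = 0") auto
    also have "\<dots> = dot d (mv d E x) (mv d E x)" by (intro dot_cong) (auto simp: zE)
    also have "\<dots> \<le> e\<^sup>2 * dot d x x" by (rule op_boundD) fact
    finally show "dot d (mv d F x) (mv d F x) \<le> e\<^sup>2 * dot d x x" by (simp add: y_def)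
  qed
  then show ?thesis
    using op_bound_sum_squares[of d F e] by (simp add: F_def T_def)
qed

text \<open>Writing A = \<beta> (I - N), the bounds on \<open>A\<close> put the form of
  \<open>N\<close> between 0 and (1 - \<alpha>/\<beta>) |x|^2. The exponent -1 is then the Neumann
  series, convergent because 1 - \<alpha>/\<beta> < 1.\<close>

lemma good_A_inverse:
  assumes "0 < \<alpha>" "\<alpha> \<le> \<beta>" "good_A \<alpha> \<beta> d A"
  shows "mat_mult d A (mat_inverse d A) = mat_id d" "mat_mult d (mat_inverse d A) A = mat_id d"
    "dmat d (mat_inverse d A)" "psd d (mat_inverse d A)"
proof -
  have sym: "symmetric_mat d A"
    and lo: "\<alpha> * dot d x x \<le> quad d A x" and up: "quad d A x \<le> \<beta> * dot d x x" for x
    using assms(3) by (auto simp: good_A_def loewner_le_def quad_scale_id)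
  define r where "r = 1 - \<alpha> / \<beta>"
  have r: "0 \<le> r" "r < 1" using assms by (auto simp: r_def)
  define N where "N = (\<lambda>i j. mat_id d i j - (1 / \<beta>) * A i j)"
  have symN: "symmetric_mat d N" unfolding N_def by (rule symmetric_id_minus_scale[OF sym])
  have N: "op_bound d N r"
  proof (rule op_bound_symmetric[OF symN r(1)])
    fix x
    have q: "quad d N x = dot d x x - (1 / \<beta>) * quad d A x"
      unfolding N_def by (rule quad_id_minus_scale)
    have "(1 / \<beta>) * quad d A x \<le> dot d x x" using up[of x] assms by (simp add: field_simps)
    moreover have "(1 / \<beta>) * quad d A x \<ge> \<alpha> / \<beta> * dot d x x" using lo[of x] assms by (simp add: field_simps)
    ultimately show "\<bar>quad d N x\<bar> \<le> r * dot d x x" unfolding q r_def by (simp add: algebra_simps)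
  qed
  have s1: "summable (\<lambda>k. \<bar>-1 gchoose k\<bar> * r ^ k)"
  proof -
    \<comment> \<open>Up to sign every coefficient is 1, so the dominating series is
      geometric.\<close>
    have "(-1 gchoose k) = ((-1) ^ k :: real)" for k
      using gbinomial_negated_upper[of "-1::real" k] binomial_gbinomial[of k k, where 'a=real] by simp
    then show ?thesis using r by (simp add: power_abs summable_geometric)
  qed
  have s2: "summable (\<lambda>k. \<bar>1 gchoose k\<bar> * r ^ k)"
    by (intro summable_finite[of "{0, 1}"]) (auto simp: gbinomial_1_left_eq_0)
  define V where "V = (\<lambda>i j. (1 / \<beta>) * binom_series d N (- 1) i j)"
  have A1: "A i j = \<beta> * binom_series d N 1 i j" if "i < d" "j < d" for i j
    using that assms by (simp add: binom_series_1 N_def)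
  have "mat_mult d A V = mat_mult d (\<lambda>i j. \<beta> * binom_series d N 1 i j) V"
    by (rule mat_mult_cong) (auto simp: A1)
  also have "\<dots> = mat_id d"
    unfolding V_def mat_mult_scale using binom_series_mult[OF N s2 s1] assms
    by (simp add: binom_series_0)
  finally have AV: "mat_mult d A V = mat_id d" .
  have "mat_mult d V A = mat_mult d V (\<lambda>i j. \<beta> * binom_series d N 1 i j)"
    by (rule mat_mult_cong) (auto simp: A1)
  also have "\<dots> = mat_id d"
    unfolding V_def mat_mult_scale using binom_series_mult[OF N s1 s2] assms
    by (simp add: binom_series_0)
  finally have VA: "mat_mult d V A = mat_id d" .
  have dV: "dmat d V" using dmat_binom_series[of d N "-1"] by (simp add: V_def dmat_def)
  have inv: "mat_inverse d A = V" by (rule mat_inverse_eq[OF dV AV VA])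
  \<comment> \<open>Substituting x = A V x makes the form of the inverse at \<open>x\<close> the
    form of \<open>A\<close> at V x.\<close>
  have "0 \<le> quad d V x" for x
  proof -
    have "quad d V x = dot d (mv d A (mv d V x)) (mv d V x)"
      unfolding quad_dot by (intro dot_cong) (simp_all add: mv_mat_id AV flip: mv_mat_mult)
    also have "\<dots> = quad d A (mv d V x)" by (simp add: quad_dot dot_commute)
    also have "\<dots> \<ge> 0" using order_trans[OF _ lo] assms dot_self_nonneg by (meson less_imp_le mult_nonneg_nonneg)
    finally show ?thesis .
  qed
  moreover have "symmetric_mat d V"
    using symmetric_binom_series[OF symN, of "-1"] by (simp add: V_def symmetric_mat_def)
  ultimately show "psd d (mat_inverse d A)" by (simp add: inv psd_def)
  show "mat_mult d A (mat_inverse d A) = mat_id d" "mat_mult d (mat_inverse d A) A = mat_id d"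
    "dmat d (mat_inverse d A)" by (simp_all add: inv AV VA dV)
qed

text \<open>The matrix sqrt 2 times the inverse of \<open>A\<close> is positive semidefinite and
  squares to \<open>Sigma d A\<close>, so by uniqueness it is the square root, and inverting it
  returns \<open>A\<close> up to the factor.\<close>

lemma Sigma_inv_half_eq:
  assumes "0 < \<alpha>" "\<alpha> \<le> \<beta>" "good_A \<alpha> \<beta> d A" "i < d" "j < d"
  shows "Sigma_inv_half d A i j = A i j / sqrt 2"
proof -
  define V where "V = mat_inverse d A"
  note V = good_A_inverse[OF assms(1-3), folded V_def]
  define S where "S = (\<lambda>i j. sqrt 2 * V i j)"
  have "quad d S x = sqrt 2 * quad d V x" for x
    by (simp add: S_def quad_def sum_distrib_left mult_ac)
  then have S: "dmat d S" "psd d S"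
    using V(3,4) by (auto simp: S_def dmat_def psd_def symmetric_mat_def)
  have "mat_sqrt d (Sigma d A) = S"
    using S by (rule mat_sqrt_eq) (simp add: S_def mat_mult_scale Sigma_def V_def)
  then have "Sigma_inv_half d A = mat_inverse d S" by (simp add: Sigma_inv_half_def)
  \<comment> \<open>The entries of \<open>A\<close> beyond \<open>d\<close> are unconstrained, while
    \<open>mat_inverse\<close> selects a matrix vanishing there, hence the truncation.\<close>
  also have "\<dots> = (\<lambda>i j. (1 / sqrt 2) * (if i < d \<and> j < d then A i j else 0))" (is "_ = ?B")
  proof (rule mat_inverse_eq)
    have "mat_mult d S ?B = mat_mult d S (\<lambda>i j. (1 / sqrt 2) * A i j)" by (rule mat_mult_cong) auto
    also have "\<dots> = mat_id d" unfolding S_def mat_mult_scale V by simp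
    finally show "mat_mult d S ?B = mat_id d" .
    have "mat_mult d ?B S = mat_mult d (\<lambda>i j. (1 / sqrt 2) * A i j) S" by (rule mat_mult_cong) auto
    also have "\<dots> = mat_id d" unfolding S_def mat_mult_scale V by simp
    finally show "mat_mult d ?B S = mat_id d" .
  qed (auto simp: dmat_def)
  finally show ?thesis using assms by simp
qed

lemma quad_add: "quad d (\<lambda>i j. M i j + N i j) x = quad d M x + quad d N x"
  by (simp add: quad_def distrib_left distrib_right sum.distrib)

lemma quad_scale: "quad d (\<lambda>i j. c * M i j) x = c * quad d M x"
  by (simp add: quad_def sum_distrib_left mult_ac)

lemma quad_sum: "quad d (\<lambda>i j. \<Sum>k\<in>K. M k i j) x = (\<Sum>k\<in>K. quad d (M k) x)"
proof -
  have "quad d (\<lambda>i j. \<Sum>k\<in>K. M k i j) x = (\<Sum>i<d. \<Sum>k\<in>K. \<Sum>j<d. x i * M k i j * x j)"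
    unfolding quad_def by (simp add: sum_distrib_left sum_distrib_right sum.swap[of _ K])
  also have "\<dots> = (\<Sum>k\<in>K. quad d (M k) x)" unfolding quad_def by (rule sum.swap)
  finally show ?thesis .
qed

lemma symmetric_matI:
  assumes "\<And>x y. dot d (mv d M x) y = dot d x (mv d M y)" shows "symmetric_mat d M"
  unfolding symmetric_mat_def
proof (intro allI impI)
  fix i j assume ij: "i < d" "j < d"
  have "M i j = dot d (unit_vec i) (mv d M (unit_vec j))" using ij by (simp add: dot_unit_vec mv_unit_vec)
  also have "\<dots> = dot d (unit_vec j) (mv d M (unit_vec i))"
    by (subst assms[symmetric]) (rule dot_commute)
  also have "\<dots> = M j i" using ij by (simp add: dot_unit_vec mv_unit_vec)
  finally show "M i j = M j i" .
qed

lemma dot_mv_mat_mult: "dot d x (mv d (mat_mult d M N) y) = dot d x (mv d M (mv d N y))"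
  by (intro dot_cong) (simp_all add: mv_mat_mult)

lemma symmetric_conj:
  assumes G: "symmetric_mat d G" and S: "symmetric_mat d S"
  shows "symmetric_mat d (mat_mult d G (mat_mult d S G))"
proof (rule symmetric_matI)
  fix x y
  have e: "dot d u (mv d (mat_mult d G (mat_mult d S G)) v) = dot d (mv d G u) (mv d S (mv d G v))" for u v
    by (simp add: dot_mv_mat_mult dot_mv_symmetric[OF G, symmetric])
  have "dot d (mv d (mat_mult d G (mat_mult d S G)) x) y = dot d (mv d G y) (mv d S (mv d G x))"
    unfolding dot_commute[of d _ y] by (rule e)
  also have "\<dots> = dot d (mv d G x) (mv d S (mv d G y))"
    using dot_mv_symmetric[OF S, of "mv d G y" "mv d G x"] by (simp add: dot_commute[of d "mv d G x"])
  also have "\<dots> = dot d x (mv d (mat_mult d G (mat_mult d S G)) y)" by (rule e[symmetric])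
  finally show "dot d (mv d (mat_mult d G (mat_mult d S G)) x) y = dot d x (mv d (mat_mult d G (mat_mult d S G)) y)" .
qed

lemma quad_conj:
  assumes G: "symmetric_mat d G"
  shows "quad d (mat_mult d G (mat_mult d S G)) x = quad d S (mv d G x)"
  by (simp add: quad_dot dot_mv_mat_mult dot_mv_symmetric[OF G, symmetric])

section \<open>Characteristic functions on \<open>\<real>\<^sup>d\<close>\<close>

text \<open>The total mass is the value of the characteristic function at 0. If it vanishes both
  measures are null; otherwise both are normalized by it and Levy's theorem for probability laws
  applies.\<close>

lemma finite_measure_char_unique:
  fixes M N :: "real measure"
  assumes "finite_measure M" "finite_measure N" and s: "sets M = sets borel" "sets N = sets borel"
    and eq: "\<And>t. char M t = char N t"
  shows "M = N"
proof -
  interpret M: finite_measure M by fact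
  interpret N: finite_measure N by fact
  have sp: "space M = UNIV" "space N = UNIV" using s[THEN sets_eq_imp_space_eq] by auto
  define m where "m = measure M UNIV"
  have m: "m = measure N UNIV"
    using eq[of 0] by (simp add: m_def char_def sp)
  have emM: "emeasure M UNIV = ennreal m" and emN: "emeasure N UNIV = ennreal m"
    using M.emeasure_eq_measure N.emeasure_eq_measure m m_def by auto
  have "m \<ge> 0" by (simp add: m_def)
  show ?thesis
  proof (cases "m = 0")
    case True
    show ?thesis
    proof (rule measure_eqI)
      fix A assume "A \<in> sets M"
      then have "emeasure M A \<le> emeasure M UNIV" "emeasure N A \<le> emeasure N UNIV"
        using s sp by (auto intro!: emeasure_mono)
      then show "emeasure M A = emeasure N A" using True emM emN by simp
    qed (simp add: s)
  next
    case False
    with \<open>m \<ge> 0\<close> have mpos: "m > 0" by simp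
    define sc where "sc L = density L (\<lambda>_. ennreal (1 / m))" for L :: "real measure"
    have sc: "real_distribution (sc L) \<and> (\<forall>t. char (sc L) t = char L t / m)"
      if L: "finite_measure L" "sets L = sets borel" "emeasure L UNIV = ennreal m" for L
    proof -
      have "emeasure (sc L) (space (sc L)) = 1"
        using L sets_eq_imp_space_eq[OF L(2)] mpos
        by (simp add: sc_def emeasure_density_const ennreal_mult[symmetric])
      then have "real_distribution (sc L)"
        unfolding real_distribution_def real_distribution_axioms_def
        using L(2) sets_eq_imp_space_eq[OF L(2)] by (auto intro!: prob_spaceI simp: sc_def)
      moreover have "char (sc L) t = char L t / m" for t
      proof -
        have [measurable_cong]: "sets L = sets borel" by fact
        have "char (sc L) t = (CLINT x|L. (1 / m) *\<^sub>R iexp (t * x))"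
          unfolding char_def sc_def using mpos by (subst integral_density) auto
        then show ?thesis unfolding char_def by (simp add: scaleR_conv_of_real)
      qed
      ultimately show ?thesis by simp
    qed
    have "sc M = sc N"
      using sc[OF assms(1) s(1) emM] sc[OF assms(2) s(2) emN] eq
      by (intro Levy_uniqueness) (auto simp: fun_eq_iff)
    show ?thesis
    proof (rule measure_eqI)
      fix A assume A: "A \<in> sets M"
      have "emeasure (sc M) A = emeasure (sc N) A" using \<open>sc M = sc N\<close> by simp
      then have "ennreal (1 / m) * emeasure M A = ennreal (1 / m) * emeasure N A"
        using A s by (simp add: sc_def emeasure_density_const)
      then show "emeasure M A = emeasure N A"
        using mpos by (subst (asm) ennreal_mult_cancel_left) auto
    qed (simp add: s)
  qed
qed

text \<open>The integrals in the hypothesis are the characteristic function of the image under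
  \<open>Y\<close> of the measure with density \<open>w\<close>. That image is a finite measure on
  the line, so its value on \<open>A\<close> is determined.\<close>

lemma weighted_char_unique:
  fixes w Y :: "'a \<Rightarrow> real"
  assumes fin: "finite_measure \<mu>" "finite_measure \<nu>" and sets: "sets \<nu> = sets \<mu>"
    and meas: "w \<in> borel_measurable \<mu>" "Y \<in> borel_measurable \<mu>"
    and w: "\<And>x. 0 \<le> w x" "\<And>x. w x \<le> B"
    and eq: "\<And>s. (CLINT x|\<mu>. complex_of_real (w x) * iexp (s * Y x)) = (CLINT x|\<nu>. complex_of_real (w x) * iexp (s * Y x))"
    and A: "A \<in> sets borel"
  shows "(LINT x|\<mu>. w x * indicat_real A (Y x)) = (LINT x|\<nu>. w x * indicat_real A (Y x))"
proof -
  note [measurable_cong] = sets and [measurable] = meas A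
  define D where "D \<rho> = distr (density \<rho> (\<lambda>x. ennreal (w x))) borel Y" for \<rho> :: "'a measure"
  have D: "finite_measure (D \<rho>) \<and> (\<forall>s. char (D \<rho>) s = (CLINT x|\<rho>. complex_of_real (w x) * iexp (s * Y x)))
      \<and> measure (D \<rho>) A = (LINT x|\<rho>. w x * indicat_real A (Y x))"
    if \<rho>: "finite_measure \<rho>" and s: "sets \<rho> = sets \<mu>" for \<rho>
  proof (intro conjI allI)
    note [measurable_cong] = s
    interpret finite_measure \<rho> by fact
    have "emeasure (D \<rho>) (space (D \<rho>)) = (\<integral>\<^sup>+x. ennreal (w x) \<partial>\<rho>)"
      by (simp add: D_def emeasure_distr emeasure_density cong: nn_integral_cong)
    also have "\<dots> \<le> (\<integral>\<^sup>+x. ennreal B \<partial>\<rho>)" by (intro nn_integral_mono ennreal_leI w)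
    also have "\<dots> < \<infinity>" by (simp add: ennreal_mult_less_top emeasure_eq_measure)
    finally show fin: "finite_measure (D \<rho>)" by (intro finite_measureI) auto
    show "char (D \<rho>) s = (CLINT x|\<rho>. complex_of_real (w x) * iexp (s * Y x))" for s
      unfolding char_def D_def using w
      by (subst integral_distr, simp, simp, subst integral_density) (auto simp: scaleR_conv_of_real)
    interpret D: finite_measure "D \<rho>" by (rule fin)
    have "measure (D \<rho>) A = (LINT x|D \<rho>. indicat_real A x)" by (simp add: D_def)
    also have "\<dots> = (LINT x|\<rho>. w x * indicat_real A (Y x))"
      unfolding D_def using w by (subst integral_distr, simp, simp, subst integral_density) auto
    finally show "measure (D \<rho>) A = (LINT x|\<rho>. w x * indicat_real A (Y x))" .
  qed
  have "D \<mu> = D \<nu>"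
    using D[OF fin(1) refl] D[OF fin(2) sets] eq
    by (intro finite_measure_char_unique) (auto simp: D_def)
  then show ?thesis using D[OF fin(1) refl] D[OF fin(2) sets] by simp
qed

lemma integrable_bounded_iexp:
  assumes "finite_measure \<mu>" "f \<in> borel_measurable \<mu>" "g \<in> borel_measurable \<mu>" "\<And>x. \<bar>f x\<bar> \<le> (B :: real)"
  shows "integrable \<mu> (\<lambda>x. complex_of_real (f x) * iexp (g x))"
proof -
  interpret finite_measure \<mu> by fact
  note [measurable] = assms
  show ?thesis by (rule integrable_const_bound[where B = B]) (auto simp: norm_mult assms)
qed

lemma iexp_cos_sin: "iexp x = complex_of_real (cos x) + \<i> * complex_of_real (sin x)"
  by (simp add: cis_conv_exp[symmetric] complex_eq_iff)

text \<open>One coordinate at a time, characters are replaced by indicator functions; the weights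
  \<open>1 + cos\<close> and \<open>1 + sin\<close> keep the measures nonnegative, so that the one-dimensional
  uniqueness theorem applies.\<close>

lemma rectangles_from_char:
  fixes \<mu> \<nu> :: "(nat \<Rightarrow> real) measure"
  assumes fin: "finite_measure \<mu>" "finite_measure \<nu>"
    and sets: "sets \<mu> = sets (Rd d)" "sets \<nu> = sets (Rd d)"
    and eq: "\<And>t. (CLINT x|\<mu>. iexp (\<Sum>j<d. t j * x j)) = (CLINT x|\<nu>. iexp (\<Sum>j<d. t j * x j))"
    and A: "\<And>j. j < d \<Longrightarrow> A j \<in> sets borel" and k: "k \<le> d"
  shows "(CLINT x|\<mu>. complex_of_real (\<Prod>j<k. indicat_real (A j) (x j)) * iexp (\<Sum>j=k..<d. t j * x j))
    = (CLINT x|\<nu>. complex_of_real (\<Prod>j<k. indicat_real (A j) (x j)) * iexp (\<Sum>j=k..<d. t j * x j))"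
  using k
proof (induction k arbitrary: t)
  case 0
  show ?case using eq[of t] by (simp add: atLeast0LessThan)
next
  case (Suc k)
  then have k: "k < d" by simp
  have comp [measurable]: "(\<lambda>x. x j) \<in> borel_measurable (Rd d)" if "j < d" for j
    using that unfolding Rd_def by (auto intro!: measurable_compose[OF measurable_component_singleton])
  note [measurable_cong] = sets
  define P where "P x = (\<Prod>j<k. indicat_real (A j) (x j))" for x :: "nat \<Rightarrow> real"
  define \<theta> where "\<theta> x = (\<Sum>j=Suc k..<d. t j * x j)" for x :: "nat \<Rightarrow> real"
  define I where "I x = indicat_real (A k) (x k)" for x :: "nat \<Rightarrow> real"
  have P01: "0 \<le> P x" "P x \<le> 1" for x
    by (auto simp: P_def indicator_def intro!: prod_nonneg prod_le_1)
  have Pm [measurable]: "P \<in> borel_measurable (Rd d)"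
    unfolding P_def using k A
    by (intro borel_measurable_prod measurable_compose[OF comp borel_measurable_indicator]) auto
  have Tm [measurable]: "\<theta> \<in> borel_measurable (Rd d)"
    unfolding \<theta>_def by measurable
  have xk [measurable]: "(\<lambda>x. x k) \<in> borel_measurable (Rd d)" by (rule comp[OF k])
  have Im [measurable]: "I \<in> borel_measurable (Rd d)"
    unfolding I_def using k A by (intro measurable_compose[OF comp borel_measurable_indicator]) auto
  have Ak: "A k \<in> sets borel" using A k by simp
  \<comment> \<open>The frequencies are free in the induction. Putting \<open>s\<close> in position
    \<open>k\<close> and scaling the remaining ones by \<open>c\<close> gives a family in which c =
    0, 1, -1 supply all the weights below.\<close>
  have IH: "(CLINT x|\<mu>. complex_of_real (P x) * iexp (s * x k + c * \<theta> x))
      = (CLINT x|\<nu>. complex_of_real (P x) * iexp (s * x k + c * \<theta> x))" for s c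
  proof -
    have "(\<Sum>j=k..<d. (if j = k then s else c * t j) * x j) = s * x k + c * \<theta> x" for x
      using k by (simp add: sum.atLeast_Suc_lessThan \<theta>_def sum_distrib_left mult.assoc)
    then show ?thesis
      using Suc.IH[of "\<lambda>j. if j = k then s else c * t j"] k by (simp add: P_def)
  qed
  have int: "integrable \<rho> (\<lambda>x. complex_of_real (P x) * iexp (s * x k + c * \<theta> x))"
    if "finite_measure \<rho>" "sets \<rho> = sets (Rd d)" for \<rho> s c
  proof -
    note [measurable_cong] = that(2)
    show ?thesis using P01 that by (intro integrable_bounded_iexp[where B = 1]) auto
  qed
  define H where "H s c x = complex_of_real (P x) * iexp (s * x k + c * \<theta> x)" for s c and x :: "nat \<Rightarrow> real"
  have H_eq: "(CLINT x|\<mu>. H s c x) = (CLINT x|\<nu>. H s c x)" for s c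
    unfolding H_def by (rule IH)
  have H_int: "integrable \<mu> (H s c)" "integrable \<nu> (H s c)" for s c
    unfolding H_def[abs_def] by (intro int fin sets)+
  \<comment> \<open>The plain weight \<open>P\<close> is treated separately in order to subtract it
    later from the shifted weights P (1 + cos) and P (1 + sin), which leaves the signed cosine and
    sine parts.\<close>
  have one: "(LINT x|\<mu>. P x * I x) = (LINT x|\<nu>. P x * I x)"
    unfolding I_def
    by (rule weighted_char_unique[OF fin _ _ _ P01 _ Ak]) (use IH[of _ 0] sets in auto)
  have cos: "(LINT x|\<mu>. P x * (1 + cos (\<theta> x)) * I x) = (LINT x|\<nu>. P x * (1 + cos (\<theta> x)) * I x)"
    unfolding I_def
  proof (rule weighted_char_unique[OF fin _ _ _ _ _ _ Ak, where B = 2])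
    fix x
    have b: "0 \<le> 1 + cos (\<theta> x)" "1 + cos (\<theta> x) \<le> 2"
      using cos_ge_minus_one[of "\<theta> x"] cos_le_one[of "\<theta> x"] by linarith+
    show "0 \<le> P x * (1 + cos (\<theta> x))" by (intro mult_nonneg_nonneg P01 b)
    have "P x * (1 + cos (\<theta> x)) \<le> 1 * 2" by (intro mult_mono P01 b) simp
    then show "P x * (1 + cos (\<theta> x)) \<le> 2" by simp
  next
    fix s
    have *: "complex_of_real (P x * (1 + cos (\<theta> x))) * iexp (s * x k)
        = H s 0 x + (H s 1 x + H s (-1) x) / 2" for x
      unfolding H_def iexp_cos_sin by (simp add: complex_eq_iff cos_add sin_add cos_diff sin_diff algebra_simps)
    show "(CLINT x|\<mu>. complex_of_real (P x * (1 + cos (\<theta> x))) * iexp (s * x k))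
        = (CLINT x|\<nu>. complex_of_real (P x * (1 + cos (\<theta> x))) * iexp (s * x k))"
      unfolding * using H_int H_eq by simp
  qed (use sets in auto)
  have sin: "(LINT x|\<mu>. P x * (1 + sin (\<theta> x)) * I x) = (LINT x|\<nu>. P x * (1 + sin (\<theta> x)) * I x)"
    unfolding I_def
  proof (rule weighted_char_unique[OF fin _ _ _ _ _ _ Ak, where B = 2])
    fix x
    have b: "0 \<le> 1 + sin (\<theta> x)" "1 + sin (\<theta> x) \<le> 2"
      using sin_ge_minus_one[of "\<theta> x"] sin_le_one[of "\<theta> x"] by linarith+
    show "0 \<le> P x * (1 + sin (\<theta> x))" by (intro mult_nonneg_nonneg P01 b)
    have "P x * (1 + sin (\<theta> x)) \<le> 1 * 2" by (intro mult_mono P01 b) simp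
    then show "P x * (1 + sin (\<theta> x)) \<le> 2" by simp
  next
    fix s
    have *: "complex_of_real (P x * (1 + sin (\<theta> x))) * iexp (s * x k)
        = H s 0 x + (H s (-1) x * \<i> - H s 1 x * \<i>) / 2" for x
      unfolding H_def iexp_cos_sin by (simp add: complex_eq_iff cos_add sin_add cos_diff sin_diff algebra_simps)
    show "(CLINT x|\<mu>. complex_of_real (P x * (1 + sin (\<theta> x))) * iexp (s * x k))
        = (CLINT x|\<nu>. complex_of_real (P x * (1 + sin (\<theta> x))) * iexp (s * x k))"
      unfolding * using H_int H_eq by simp
  qed (use sets in auto)
  have bnd: "integrable \<rho> (\<lambda>x. P x * f x * I x)"
    if "finite_measure \<rho>" "sets \<rho> = sets (Rd d)" "f \<in> borel_measurable (Rd d)" "\<And>x. \<bar>f x\<bar> \<le> 2" for \<rho> f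
  proof -
    interpret finite_measure \<rho> by fact
    note [measurable_cong] = that(2) and [measurable] = that(3)
    have "\<bar>P x * f x * I x\<bar> \<le> 2" for x
    proof -
      have "\<bar>P x * f x * I x\<bar> \<le> 1 * 2 * 1"
        unfolding abs_mult using P01 that(4) by (intro mult_mono) (auto simp: I_def indicator_def)
      then show ?thesis by simp
    qed
    then show ?thesis by (intro integrable_const_bound[where B = 2]) auto
  qed
  have bd: "integrable \<rho> (\<lambda>x. P x * I x)" "integrable \<rho> (\<lambda>x. P x * cos (\<theta> x) * I x)"
      "integrable \<rho> (\<lambda>x. P x * sin (\<theta> x) * I x)"
    if "finite_measure \<rho>" "sets \<rho> = sets (Rd d)" for \<rho>
  proof -
    have "\<bar>cos y\<bar> \<le> 2" "\<bar>sin y\<bar> \<le> 2" for y :: real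
      using abs_cos_le_one[of y] abs_sin_le_one[of y] by linarith+
    then show "integrable \<rho> (\<lambda>x. P x * I x)" "integrable \<rho> (\<lambda>x. P x * cos (\<theta> x) * I x)"
        "integrable \<rho> (\<lambda>x. P x * sin (\<theta> x) * I x)"
      using bnd[OF that, of "\<lambda>_. 1"] bnd[OF that, of "\<lambda>x. cos (\<theta> x)"] bnd[OF that, of "\<lambda>x. sin (\<theta> x)"]
      by simp_all
  qed
  have cos': "(LINT x|\<mu>. P x * cos (\<theta> x) * I x) = (LINT x|\<nu>. P x * cos (\<theta> x) * I x)"
    using cos one bd[OF fin(1) sets(1)] bd[OF fin(2) sets(2)] by (simp add: distrib_left distrib_right)
  have sin': "(LINT x|\<mu>. P x * sin (\<theta> x) * I x) = (LINT x|\<nu>. P x * sin (\<theta> x) * I x)"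
    using sin one bd[OF fin(1) sets(1)] bd[OF fin(2) sets(2)] by (simp add: distrib_left distrib_right)
  have split: "(CLINT x|\<rho>. complex_of_real (\<Prod>j<Suc k. indicat_real (A j) (x j)) * iexp (\<theta> x))
      = complex_of_real (LINT x|\<rho>. P x * cos (\<theta> x) * I x) + \<i> * complex_of_real (LINT x|\<rho>. P x * sin (\<theta> x) * I x)"
    if "finite_measure \<rho>" "sets \<rho> = sets (Rd d)" for \<rho>
  proof -
    define u v where "u x = P x * cos (\<theta> x) * I x" and "v x = P x * sin (\<theta> x) * I x" for x
    have *: "complex_of_real (\<Prod>j<Suc k. indicat_real (A j) (x j)) * iexp (\<theta> x)
        = complex_of_real (u x) + \<i> * complex_of_real (v x)" for x
      unfolding iexp_cos_sin by (simp add: u_def v_def P_def I_def algebra_simps)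
    have "integrable \<rho> u" "integrable \<rho> v"
      using bd[OF that] by (simp_all add: u_def[abs_def] v_def[abs_def])
    then show ?thesis unfolding * u_def[symmetric] v_def[symmetric] by simp
  qed
  show ?case
    using split[OF fin(1) sets(1)] split[OF fin(2) sets(2)] cos' sin' by (simp add: \<theta>_def)
qed

text \<open>Once every coordinate has been converted to an indicator, the integrals are the measures
  of rectangles, which determine a finite measure on the product space.\<close>

theorem char_unique_Rd:
  fixes \<mu> \<nu> :: "(nat \<Rightarrow> real) measure"
  assumes fin: "finite_measure \<mu>" "finite_measure \<nu>"
    and sets: "sets \<mu> = sets (Rd d)" "sets \<nu> = sets (Rd d)"
    and eq: "\<And>t. (CLINT x|\<mu>. iexp (\<Sum>j<d. t j * x j)) = (CLINT x|\<nu>. iexp (\<Sum>j<d. t j * x j))"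
  shows "\<mu> = \<nu>"
proof (rule measure_eqI_PiM_finite)
  show "finite {..<d}" "sets \<mu> = sets (PiM {..<d} (\<lambda>_. lborel))" "sets \<nu> = sets (PiM {..<d} (\<lambda>_. lborel))"
    using sets by (simp_all add: Rd_def)
  interpret mu: finite_measure \<mu> by fact
  interpret nu: finite_measure \<nu> by fact
  fix A :: "nat \<Rightarrow> real set" assume A: "\<And>i. i \<in> {..<d} \<Longrightarrow> A i \<in> sets lborel"
  have R: "Pi\<^sub>E {..<d} A \<in> sets (Rd d)" unfolding Rd_def using A by (intro sets_PiM_I_finite) auto
  have m: "complex_of_real (measure \<rho> (Pi\<^sub>E {..<d} A)) = (CLINT x|\<rho>. complex_of_real (\<Prod>j<d. indicat_real (A j) (x j)) * iexp (\<Sum>j=d..<d. 0 * x j))"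
    if "finite_measure \<rho>" "sets \<rho> = sets (Rd d)" for \<rho>
  proof -
    have sp: "space \<rho> = space (Rd d)" using that(2) by (rule sets_eq_imp_space_eq)
    have "(CLINT x|\<rho>. complex_of_real (\<Prod>j<d. indicat_real (A j) (x j)) * iexp (\<Sum>j=d..<d. 0 * x j))
        = (CLINT x|\<rho>. complex_of_real (indicat_real (Pi\<^sub>E {..<d} A) x))"
    proof (rule Bochner_Integration.integral_cong[OF refl])
      fix x assume "x \<in> space \<rho>"
      \<comment> \<open>Points of the space are extensional, so lying in the rectangle is exactly
        the condition on the coordinates below \<open>d\<close>.\<close>
      then have "x \<in> Pi\<^sub>E {..<d} (\<lambda>_. UNIV)" by (simp add: sp Rd_def space_PiM)
      then have "(\<Prod>j<d. indicat_real (A j) (x j)) = indicat_real (Pi\<^sub>E {..<d} A) x"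
        by (auto simp: indicator_def PiE_iff)
      then show "complex_of_real (\<Prod>j<d. indicat_real (A j) (x j)) * iexp (\<Sum>j=d..<d. 0 * x j)
          = complex_of_real (indicat_real (Pi\<^sub>E {..<d} A) x)" by simp
    qed
    then show ?thesis using R that sp by (simp add: sets.Int_space_eq2)
  qed
  have "complex_of_real (measure \<mu> (Pi\<^sub>E {..<d} A)) = complex_of_real (measure \<nu> (Pi\<^sub>E {..<d} A))"
    unfolding m[OF fin(1) sets(1)] m[OF fin(2) sets(2)]
    by (rule rectangles_from_char[OF fin sets eq]) (use A in auto)
  then show "emeasure \<mu> (Pi\<^sub>E {..<d} A) = emeasure \<nu> (Pi\<^sub>E {..<d} A)"
    by (simp add: mu.emeasure_eq_measure nu.emeasure_eq_measure)
next
  interpret mu: finite_measure \<mu> by fact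
  show "range (\<lambda>_::nat. space (PiM {..<d} (\<lambda>_. lborel :: real measure))) \<subseteq> prod_algebra {..<d} (\<lambda>_. lborel)"
    by (auto simp: space_PiM intro!: prod_algebraI_finite)
  show "emeasure \<mu> (space (PiM {..<d} (\<lambda>_. lborel))) \<noteq> \<infinity>" by simp
qed simp

section \<open>Gaussian laws and couplings\<close>

lemma sets_gauss [measurable_cong]: "sets (gauss d) = sets (Rd d)"
  unfolding gauss_def Rd_def by (intro sets_PiM_cong) auto

lemma prob_space_gauss: "prob_space (gauss d)"
  unfolding gauss_def using prob_space_normal_density by (intro prob_space_PiM) auto

lemma measurable_component_Rd: "i < d \<Longrightarrow> (\<lambda>x. x i) \<in> borel_measurable (Rd d)"
  unfolding Rd_def by (auto intro!: measurable_compose[OF measurable_component_singleton])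

text \<open>The carrier of \<open>Rd d\<close> consists of extensional functions; this is why
  \<open>mat_vec\<close> and \<open>noise_average\<close> take the value \<open>undefined\<close>
  beyond \<open>d\<close>.\<close>

lemma measurable_into_Rd:
  assumes "\<And>i. i < d \<Longrightarrow> (\<lambda>\<omega>. U \<omega> i) \<in> borel_measurable M" "\<And>\<omega> i. d \<le> i \<Longrightarrow> U \<omega> i = undefined"
  shows "U \<in> measurable M (Rd d)"
  unfolding Rd_def using assms by (intro measurable_PiM_single') (auto simp: PiE_iff extensional_def)

lemma borel_measurable_iexp: "f \<in> borel_measurable M \<Longrightarrow> (\<lambda>x. iexp (f x)) \<in> borel_measurable M"
  by measurable

lemma measurable_mat_vec: "mat_vec d T \<in> measurable (Rd d) (Rd d)"
  by (rule measurable_into_Rd) (auto simp: mat_vec_def intro!: borel_measurable_sum borel_measurable_times measurable_component_Rd)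

lemma gauss_char:
  "(CLINT x|gauss d. iexp (\<Sum>j<d. t j * x j)) = complex_of_real (exp (- dot d t t / 2))"
proof -
  interpret N: real_distribution std_normal_distribution by (rule real_dist_normal_dist)
  interpret product_sigma_finite "\<lambda>_::nat. std_normal_distribution"
    by unfold_locales
  have "(CLINT x|gauss d. iexp (\<Sum>j<d. t j * x j)) = (CLINT x|gauss d. \<Prod>j<d. iexp (t j * x j))"
    by (simp add: exp_sum sum_distrib_left)
  also have "\<dots> = (\<Prod>j<d. CLINT y|std_normal_distribution. iexp (t j * y))"
    unfolding gauss_def
    by (rule product_integral_prod) (auto intro!: N.integrable_const_bound[where B = 1])
  also have "\<dots> = (\<Prod>j<d. complex_of_real (exp (- ((t j)\<^sup>2) / 2)))"
    using char_std_normal_distribution by (simp add: char_def fun_eq_iff)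
  also have "\<dots> = complex_of_real (exp (\<Sum>j<d. - ((t j)\<^sup>2) / 2))" by (simp add: exp_sum)
  also have "(\<Sum>j<d. - ((t j)\<^sup>2) / 2) = - dot d t t / 2"
    by (simp add: dot_def power2_eq_square sum_negf flip: sum_divide_distrib)
  finally show ?thesis .
qed

text \<open>Finitely many noise vectors occur; they are independent with law \<open>gauss d\<close>,
  so the exponential factors.\<close>

lemma noise_char:
  assumes "finite K"
  shows "(CLINT \<xi>|PiM UNIV (\<lambda>_::nat. gauss d). iexp (\<Sum>k\<in>K. \<Sum>j<d. u k j * \<xi> k j))
    = complex_of_real (exp (- (\<Sum>k\<in>K. dot d (u k) (u k)) / 2))"
proof -
  define M where "M = PiM UNIV (\<lambda>_::nat. gauss d)"
  interpret G: prob_space "gauss d" by (rule prob_space_gauss)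
  interpret M: prob_space M unfolding M_def by (intro prob_space_PiM prob_space_gauss)
  define Y where "Y k x = iexp (\<Sum>j<d. u k j * x j)" for k :: nat and x :: "nat \<Rightarrow> real"
  have Ym [measurable]: "Y k \<in> borel_measurable (gauss d)" for k
  proof -
    have [measurable]: "(\<lambda>x. \<Sum>j<d. u k j * x j) \<in> borel_measurable (gauss d)"
      by (intro borel_measurable_sum borel_measurable_times) (auto simp: measurable_component_Rd cong: measurable_cong_sets sets_gauss)
    show ?thesis unfolding Y_def by measurable
  qed
  have comp: "distr M (gauss d) (\<lambda>\<omega>. \<omega> k) = gauss d" for k
    unfolding M_def by (rule distr_PiM_component) (auto intro: prob_space_gauss)
  have cm [measurable]: "(\<lambda>\<omega>. \<omega> k) \<in> measurable M (gauss d)" for k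
    unfolding M_def by measurable
  \<comment> \<open>The joint law of all coordinate maps is the product measure itself, which is the
    criterion for their independence.\<close>
  have "M.indep_vars (\<lambda>_. gauss d) (\<lambda>k \<omega>. \<omega> k) UNIV"
    by (subst M.indep_vars_iff_distr_eq_PiM)
      (simp_all add: comp[unfolded M_def] M_def distr_id2 cm[unfolded M_def] restrict_UNIV)
  then have "M.indep_vars (\<lambda>_. borel) (\<lambda>k \<omega>. Y k (\<omega> k)) UNIV"
    by (rule M.indep_vars_compose2) (rule Ym)
  then have ind: "M.indep_vars (\<lambda>_. borel) (\<lambda>k \<omega>. Y k (\<omega> k)) K"
    by (rule M.indep_vars_subset) simp
  have "(CLINT \<xi>|M. iexp (\<Sum>k\<in>K. \<Sum>j<d. u k j * \<xi> k j)) = (CLINT \<xi>|M. \<Prod>k\<in>K. Y k (\<xi> k))"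
    using assms by (simp add: Y_def exp_sum[symmetric] sum_distrib_left)
  also have "\<dots> = (\<Prod>k\<in>K. CLINT \<xi>|M. Y k (\<xi> k))"
  proof (rule M.indep_vars_lebesgue_integral[OF assms ind])
    fix k show "integrable M (\<lambda>\<omega>. Y k (\<omega> k))"
    proof (rule M.integrable_const_bound[where B = 1])
      show "(\<lambda>\<omega>. Y k (\<omega> k)) \<in> borel_measurable M" by (rule measurable_compose[OF cm Ym])
    qed (simp add: Y_def)
  qed
  also have "\<dots> = (\<Prod>k\<in>K. complex_of_real (exp (- dot d (u k) (u k) / 2)))"
  proof (rule prod.cong[OF refl])
    fix k
    have "(CLINT \<xi>|M. Y k (\<xi> k)) = (CLINT x|distr M (gauss d) (\<lambda>\<omega>. \<omega> k). Y k x)"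
      by (rule integral_distr[symmetric]) auto
    then show "(CLINT \<xi>|M. Y k (\<xi> k)) = complex_of_real (exp (- dot d (u k) (u k) / 2))"
      unfolding comp by (simp only: Y_def gauss_char)
  qed
  also have "\<dots> = complex_of_real (exp (- (\<Sum>k\<in>K. dot d (u k) (u k)) / 2))"
    using assms by (simp add: exp_sum sum_divide_distrib flip: sum_negf)
  finally show ?thesis by (simp add: M_def)
qed

lemma measurable_fst_component:
  "sets \<mu>0 = sets (Rd d) \<Longrightarrow> i < d \<Longrightarrow> (\<lambda>\<omega>. fst \<omega> i) \<in> borel_measurable (chain_space d \<mu>0)"
  unfolding chain_space_def
  by (rule measurable_compose[OF measurable_fst]) (simp add: measurable_component_Rd cong: measurable_cong_sets)

lemma measurable_snd_component:
  assumes "i < d" shows "(\<lambda>\<omega>. snd \<omega> k i) \<in> borel_measurable (chain_space d \<mu>0)"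
proof -
  have "(\<lambda>\<omega>. snd \<omega> k) \<in> measurable (\<mu>0 \<Otimes>\<^sub>M PiM UNIV (\<lambda>_::nat. gauss d)) (gauss d)"
    by measurable
  then show ?thesis unfolding chain_space_def
    by (rule measurable_compose) (simp add: assms measurable_component_Rd cong: measurable_cong_sets sets_gauss)
qed

lemma prob_space_chain_space: "prob_space \<mu>0 \<Longrightarrow> prob_space (chain_space d \<mu>0)"
  unfolding chain_space_def by (intro prob_space_pair prob_space_PiM prob_space_gauss)

text \<open>Fubini separates the initial state from the noise. Every law and moment of a linear
  functional of the chain is read off from this one formula.\<close>

lemma chain_space_char:
  assumes \<mu>0: "prob_space \<mu>0" "sets \<mu>0 = sets (Rd d)" and K: "finite K"
  shows "(CLINT \<omega>|chain_space d \<mu>0. iexp (dot d a (fst \<omega>) + (\<Sum>k\<in>K. \<Sum>j<d. u k j * snd \<omega> k j)))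
    = (CLINT x|\<mu>0. iexp (dot d a x)) * complex_of_real (exp (- (\<Sum>k\<in>K. dot d (u k) (u k)) / 2))"
proof -
  define M where "M = PiM UNIV (\<lambda>_::nat. gauss d)"
  interpret M: prob_space M unfolding M_def by (intro prob_space_PiM prob_space_gauss)
  interpret P: prob_space \<mu>0 by fact
  interpret C: prob_space "chain_space d \<mu>0" by (rule prob_space_chain_space) fact
  interpret pair_sigma_finite \<mu>0 M ..
  define f where "f \<omega> = iexp (dot d a (fst \<omega>) + (\<Sum>k\<in>K. \<Sum>j<d. u k j * snd \<omega> k j))"
    for \<omega> :: "(nat \<Rightarrow> real) \<times> (nat \<Rightarrow> nat \<Rightarrow> real)"
  have m: "(\<lambda>\<omega>. dot d a (fst \<omega>) + (\<Sum>k\<in>K. \<Sum>j<d. u k j * snd \<omega> k j)) \<in> borel_measurable (chain_space d \<mu>0)"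
    unfolding dot_def
    by (intro borel_measurable_add borel_measurable_sum borel_measurable_times measurable_const
        measurable_fst_component[OF \<mu>0(2)] measurable_snd_component) auto
  have int: "integrable (\<mu>0 \<Otimes>\<^sub>M M) f"
    unfolding M_def chain_space_def[symmetric]
    by (rule C.integrable_const_bound[where B = 1])
      (simp add: f_def, unfold f_def[abs_def], rule borel_measurable_iexp[OF m])
  have "(CLINT \<omega>|chain_space d \<mu>0. f \<omega>) = (CLINT x|\<mu>0. CLINT \<xi>|M. f (x, \<xi>))"
    unfolding chain_space_def M_def[symmetric] by (rule integral_fst'[OF int, symmetric])
  also have "\<dots> = (CLINT x|\<mu>0. CLINT \<xi>|M. iexp (dot d a x) * iexp (\<Sum>k\<in>K. \<Sum>j<d. u k j * \<xi> k j))"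
    by (simp add: f_def distrib_left exp_add)
  also have "\<dots> = (CLINT x|\<mu>0. iexp (dot d a x)) * complex_of_real (exp (- (\<Sum>k\<in>K. dot d (u k) (u k)) / 2))"
    unfolding M_def by (simp only: integral_mult_right_zero integral_mult_left_zero noise_char[OF K])
  finally show ?thesis by (simp add: f_def)
qed

text \<open>Levy's theorem identifies the law of \<open>Y\<close> with that of sqrt v times a
  standard normal variable, degenerate case v = 0 included. Thus variances of linear noise
  functionals follow from characteristic functions, with no expansion into cross terms.\<close>

lemma second_moment_from_char:
  assumes "prob_space M" and Y: "Y \<in> borel_measurable M" and v: "0 \<le> v"
    and eq: "\<And>s. (CLINT x|M. iexp (s * Y x)) = complex_of_real (exp (- (s\<^sup>2 * v) / 2))"
  shows "(\<integral>\<^sup>+x. ennreal ((Y x)\<^sup>2) \<partial>M) = ennreal v"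
proof -
  note [measurable] = Y
  interpret prob_space M by fact
  interpret N: real_distribution std_normal_distribution by (rule real_dist_normal_dist)
  have "distr M borel Y = distr std_normal_distribution borel (\<lambda>x. sqrt v * x)"
  proof (rule Levy_uniqueness)
    show "real_distribution (distr M borel Y)"
      by (rule real_distribution_distr) simp
    show "real_distribution (distr std_normal_distribution borel (\<lambda>x. sqrt v * x))"
      by (rule N.real_distribution_distr) simp
    show "char (distr M borel Y) = char (distr std_normal_distribution borel (\<lambda>x. sqrt v * x))"
    proof
      fix s
      have "char (distr M borel Y) s = complex_of_real (exp (- (s\<^sup>2 * v) / 2))"
        unfolding char_def by (subst integral_distr, simp, simp) (rule eq)
      moreover have "char (distr std_normal_distribution borel (\<lambda>x. sqrt v * x)) s = char std_normal_distribution (s * sqrt v)"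
        unfolding char_def by (subst integral_distr) (auto simp: mult.assoc)
      ultimately show "char (distr M borel Y) s = char (distr std_normal_distribution borel (\<lambda>x. sqrt v * x)) s"
        using v by (simp add: char_std_normal_distribution power_mult_distrib)
    qed
  qed
  note D = this
  have "(\<integral>\<^sup>+x. ennreal ((Y x)\<^sup>2) \<partial>M) = (\<integral>\<^sup>+y. ennreal (y\<^sup>2) \<partial>distr M borel Y)"
    by (subst nn_integral_distr) auto
  also have "\<dots> = (\<integral>\<^sup>+x. ennreal v * ennreal (x\<^sup>2) \<partial>std_normal_distribution)"
    unfolding D using v by (subst nn_integral_distr) (auto simp: power_mult_distrib ennreal_mult)
  also have "\<dots> = ennreal v * (\<integral>\<^sup>+x. ennreal (x\<^sup>2) \<partial>std_normal_distribution)"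
    by (rule nn_integral_cmult) simp
  also have "(\<integral>\<^sup>+x. ennreal (x\<^sup>2) \<partial>std_normal_distribution) = ennreal 1"
    using std_normal_distribution_even_moments[of 1]
    by (subst nn_integral_eq_integral) (auto simp: numeral_2_eq_2)
  finally show ?thesis by simp
qed

text \<open>The joint law of two random vectors on one probability space is a coupling of their
  laws; this is the source of every upper bound on the distance.\<close>

lemma W2_sq_le:
  assumes "prob_space P" and U: "U \<in> measurable P (Rd d)" and V: "V \<in> measurable P (Rd d)"
  shows "W2_sq d (distr P (Rd d) U) (distr P (Rd d) V) \<le> (\<integral>\<^sup>+\<omega>. ennreal (\<Sum>i<d. (U \<omega> i - V \<omega> i)\<^sup>2) \<partial>P)"
proof -
  note [measurable] = U V
  interpret prob_space P by fact
  define \<pi> where "\<pi> = distr P (Rd d \<Otimes>\<^sub>M Rd d) (\<lambda>\<omega>. (U \<omega>, V \<omega>))"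
  have "\<pi> \<in> couplings d (distr P (Rd d) U) (distr P (Rd d) V)"
    unfolding couplings_def
    by (auto simp: \<pi>_def distr_distr comp_def intro!: prob_space_distr)
  then have "W2_sq d (distr P (Rd d) U) (distr P (Rd d) V) \<le> (\<integral>\<^sup>+z. ennreal (\<Sum>i<d. (fst z i - snd z i)\<^sup>2) \<partial>\<pi>)"
    unfolding W2_sq_def by (rule INF_lower)
  also have "\<dots> = (\<integral>\<^sup>+\<omega>. ennreal (\<Sum>i<d. (U \<omega> i - V \<omega> i)\<^sup>2) \<partial>P)"
  proof -
    have "(\<lambda>z. \<Sum>i<d. (fst z i - snd z i)\<^sup>2) \<in> borel_measurable (Rd d \<Otimes>\<^sub>M Rd d)"
      by (intro borel_measurable_sum borel_measurable_power borel_measurable_diff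
          measurable_compose[OF measurable_fst] measurable_compose[OF measurable_snd]) (auto intro: measurable_component_Rd)
    then show ?thesis unfolding \<pi>_def by (subst nn_integral_distr) auto
  qed
  finally show ?thesis .
qed

lemma gauss_linear_second_moment:
  "(\<integral>\<^sup>+x. ennreal (\<Sum>i<d. (\<Sum>j<d. F i j * x j)\<^sup>2) \<partial>gauss d) = ennreal (\<Sum>i<d. \<Sum>j<d. (F i j)\<^sup>2)"
proof -
  have m: "(\<lambda>x. \<Sum>j<d. F i j * x j) \<in> borel_measurable (gauss d)" for i
    by (intro borel_measurable_sum borel_measurable_times) (auto simp: measurable_component_Rd cong: measurable_cong_sets sets_gauss)
  have "(\<integral>\<^sup>+x. ennreal ((\<Sum>j<d. F i j * x j)\<^sup>2) \<partial>gauss d) = ennreal (\<Sum>j<d. (F i j)\<^sup>2)" for i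
  proof (rule second_moment_from_char[OF prob_space_gauss m])
    fix s
    show "(CLINT x|gauss d. iexp (s * (\<Sum>j<d. F i j * x j))) = complex_of_real (exp (- (s\<^sup>2 * (\<Sum>j<d. (F i j)\<^sup>2)) / 2))"
      using gauss_char[of d "\<lambda>j. s * F i j"]
      by (simp add: dot_linear) (simp add: dot_def sum_distrib_left mult.assoc power2_eq_square)
  qed (simp add: sum_nonneg)
  then show ?thesis using m
    by (simp add: nn_integral_sum sum_nonneg flip: sum_ennreal)
qed

lemma noise_linear_second_moment:
  assumes "prob_space \<mu>0" "sets \<mu>0 = sets (Rd d)" and K: "finite K"
  shows "(\<integral>\<^sup>+\<omega>. ennreal (\<Sum>i<d. (\<Sum>k\<in>K. \<Sum>j<d. G k i j * snd \<omega> k j)\<^sup>2) \<partial>chain_space d \<mu>0)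
    = ennreal (\<Sum>i<d. \<Sum>k\<in>K. \<Sum>j<d. (G k i j)\<^sup>2)"
proof -
  interpret prob_space \<mu>0 by fact
  have m: "(\<lambda>\<omega>. \<Sum>k\<in>K. \<Sum>j<d. G k i j * snd \<omega> k j) \<in> borel_measurable (chain_space d \<mu>0)" for i
    by (intro borel_measurable_sum borel_measurable_times measurable_const measurable_snd_component) auto
  have "(\<integral>\<^sup>+\<omega>. ennreal ((\<Sum>k\<in>K. \<Sum>j<d. G k i j * snd \<omega> k j)\<^sup>2) \<partial>chain_space d \<mu>0)
      = ennreal (\<Sum>k\<in>K. \<Sum>j<d. (G k i j)\<^sup>2)" for i
  proof (rule second_moment_from_char[OF prob_space_chain_space m])
    fix s
    show "(CLINT \<omega>|chain_space d \<mu>0. iexp (s * (\<Sum>k\<in>K. \<Sum>j<d. G k i j * snd \<omega> k j)))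
        = complex_of_real (exp (- (s\<^sup>2 * (\<Sum>k\<in>K. \<Sum>j<d. (G k i j)\<^sup>2)) / 2))"
      using chain_space_char[OF assms(1,2) K, of "\<lambda>_. 0" "\<lambda>k j. s * G k i j"] prob_space
      by (simp add: dot_linear) (simp add: dot_def sum_distrib_left mult.assoc power2_eq_square)
  qed (auto simp: sum_nonneg assms)
  then show ?thesis using m
    by (simp add: nn_integral_sum sum_nonneg flip: sum_ennreal)
qed

text \<open>The symmetric root moves from the Gaussian vector to \<open>t\<close>, and the squared
  length of the image of \<open>t\<close> is the form of \<open>S\<close>.\<close>

lemma gaussian_law_char:
  assumes "psd d S"
  shows "(CLINT x|gaussian_law d S. iexp (\<Sum>j<d. t j * x j)) = complex_of_real (exp (- quad d S t / 2))"
proof -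
  define T where "T = mat_sqrt d S"
  have symT: "symmetric_mat d T" using psd_mat_sqrt(1)[OF assms] by (simp add: psd_def T_def)
  have m: "mat_vec d T \<in> measurable (gauss d) (Rd d)"
    using measurable_mat_vec by (simp cong: measurable_cong_sets add: sets_gauss)
  have m2: "(\<lambda>x. \<Sum>j<d. t j * x j) \<in> borel_measurable (Rd d)"
    by (intro borel_measurable_sum borel_measurable_times) (auto simp: measurable_component_Rd)
  have "(CLINT x|gaussian_law d S. iexp (\<Sum>j<d. t j * x j)) = (CLINT x|gauss d. iexp (\<Sum>j<d. t j * mat_vec d T x j))"
    unfolding gaussian_law_def T_def[symmetric] by (rule integral_distr[OF m borel_measurable_iexp[OF m2]])
  also have "(\<lambda>x. \<Sum>j<d. t j * mat_vec d T x j) = (\<lambda>x. \<Sum>j<d. mv d T t j * x j)"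
  proof
    fix x
    have "(\<Sum>j<d. t j * mat_vec d T x j) = dot d t (mv d T x)" by (simp add: dot_def mv_def mat_vec_def)
    then show "(\<Sum>j<d. t j * mat_vec d T x j) = (\<Sum>j<d. mv d T t j * x j)"
      by (simp add: dot_mv_symmetric[OF symT, symmetric]) (simp add: dot_def)
  qed
  finally show ?thesis
    unfolding gauss_char by (simp add: quad_mat_sqrt[OF assms] T_def)
qed

text \<open>Only the law of \<open>U\<close> matters, so \<open>U\<close> is replaced by a linear
  image of a standard Gaussian and the coupling is built on \<open>gauss d\<close> instead of
  \<open>P\<close>. The cost is then the squared Frobenius distance of the root from the
  identity.\<close>

lemma W2_sq_gaussian_le:
  assumes P: "prob_space P" and U: "U \<in> measurable P (Rd d)" and S: "psd d S"
    and char: "\<And>t. (CLINT \<omega>|P. iexp (\<Sum>j<d. t j * U \<omega> j)) = complex_of_real (exp (- quad d S t / 2))"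
    and e: "0 \<le> e" "\<And>x. \<bar>quad d S x - dot d x x\<bar> \<le> e * dot d x x"
  shows "W2_sq d (distr P (Rd d) U) (gauss d) \<le> ennreal (real d * e\<^sup>2)"
proof -
  define T where "T = mat_sqrt d S"
  interpret P: prob_space P by fact
  interpret G: prob_space "gauss d" by (rule prob_space_gauss)
  have m: "mat_vec d T \<in> measurable (gauss d) (Rd d)"
    using measurable_mat_vec by (simp cong: measurable_cong_sets add: sets_gauss)
  have m2: "(\<lambda>x. \<Sum>j<d. t j * x j) \<in> borel_measurable (Rd d)" for t
    by (intro borel_measurable_sum borel_measurable_times) (auto simp: measurable_component_Rd)
  have law: "distr P (Rd d) U = gaussian_law d S"
  proof (rule char_unique_Rd)
    show "finite_measure (distr P (Rd d) U)"
      using P.prob_space_distr[OF U] by (simp add: prob_space_def)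
    show "finite_measure (gaussian_law d S)"
      using G.prob_space_distr[OF m] by (simp add: prob_space_def gaussian_law_def T_def)
    show "(CLINT x|distr P (Rd d) U. iexp (\<Sum>j<d. t j * x j)) = (CLINT x|gaussian_law d S. iexp (\<Sum>j<d. t j * x j))" for t
      unfolding gaussian_law_char[OF S] integral_distr[OF U borel_measurable_iexp[OF m2]] by (rule char)
  qed (simp_all add: gaussian_law_def)
  have "W2_sq d (gaussian_law d S) (distr (gauss d) (Rd d) (\<lambda>x. x))
      \<le> (\<integral>\<^sup>+x. ennreal (\<Sum>i<d. (mat_vec d T x i - x i)\<^sup>2) \<partial>gauss d)"
    unfolding gaussian_law_def T_def[symmetric]
    by (rule W2_sq_le[OF prob_space_gauss m]) (simp add: measurable_ident_sets sets_gauss)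
  also have "(\<lambda>x. \<Sum>i<d. (mat_vec d T x i - x i)\<^sup>2) = (\<lambda>x. \<Sum>i<d. (\<Sum>j<d. (T i j - mat_id d i j) * x j)\<^sup>2)"
  proof (intro ext sum.cong refl)
    fix x :: "nat \<Rightarrow> real" and i assume "i \<in> {..<d}"
    then show "(mat_vec d T x i - x i)\<^sup>2 = (\<Sum>j<d. (T i j - mat_id d i j) * x j)\<^sup>2"
      using mv_mat_id[of i d x] by (simp add: mat_vec_def mv_def left_diff_distrib sum_subtractf)
  qed
  also have "(\<integral>\<^sup>+x. ennreal (\<Sum>i<d. (\<Sum>j<d. (T i j - mat_id d i j) * x j)\<^sup>2) \<partial>gauss d)
      = ennreal (\<Sum>i<d. \<Sum>j<d. (T i j - mat_id d i j)\<^sup>2)"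
    by (rule gauss_linear_second_moment)
  also have "\<dots> \<le> ennreal (real d * e\<^sup>2)"
    unfolding T_def by (intro ennreal_leI mat_sqrt_id_frobenius S e)
  also have "distr (gauss d) (Rd d) (\<lambda>x. x) = gauss d" by (simp add: distr_id2 sets_gauss)
  finally show ?thesis by (simp add: law)
qed

section \<open>The chain\<close>

definition step_mat :: "nat \<Rightarrow> (nat \<Rightarrow> nat \<Rightarrow> real) \<Rightarrow> real \<Rightarrow> nat \<Rightarrow> nat \<Rightarrow> real" where
  "step_mat d A \<eta> = (\<lambda>i j. mat_id d i j - \<eta> * A i j)"

lemma mv_step_mat: "i < d \<Longrightarrow> mv d (step_mat d A \<eta>) x i = x i - \<eta> * mv d A x i"
  unfolding step_mat_def by (rule mv_id_minus_scale)

lemma mv_sum: "mv d M (\<lambda>i. \<Sum>k\<in>K. x k i) = (\<lambda>i. \<Sum>k\<in>K. mv d M (x k) i)"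
  unfolding mv_def sum_distrib_left by (subst sum.swap) (rule refl)

lemma chain_eq:
  assumes "i < d"
  shows "chain d A \<eta> \<omega> m i = mv d (mpow d (step_mat d A \<eta>) m) (fst \<omega>) i
    + sqrt (2 * \<eta>) * (\<Sum>k=1..m. mv d (mpow d (step_mat d A \<eta>) (m - k)) (snd \<omega> k) i)"
  using assms
proof (induction m arbitrary: i)
  case 0
  then show ?case by (simp add: mv_mat_id)
next
  case (Suc m)
  define B where "B = step_mat d A \<eta>"
  define X where "X i = mv d (mpow d B m) (fst \<omega>) i + sqrt (2 * \<eta>) * (\<Sum>k=1..m. mv d (mpow d B (m - k)) (snd \<omega> k) i)" for i
  have "chain d A \<eta> \<omega> (Suc m) i = mv d B (chain d A \<eta> \<omega> m) i + sqrt (2 * \<eta>) * snd \<omega> (Suc m) i"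
    using Suc.prems unfolding B_def mv_step_mat[OF Suc.prems] by (simp add: mv_def)
  also have "mv d B (chain d A \<eta> \<omega> m) = mv d B X"
    by (rule mv_cong) (use Suc.IH in \<open>simp add: X_def B_def\<close>)
  also have "mv d B X i = mv d (mpow d B (Suc m)) (fst \<omega>) i
      + sqrt (2 * \<eta>) * (\<Sum>k=1..m. mv d (mpow d B (Suc (m - k))) (snd \<omega> k) i)"
    using Suc.prems unfolding X_def[abs_def] mv_linear mv_sum by (simp add: mv_mat_mult)
  also have "(\<Sum>k=1..m. mv d (mpow d B (Suc (m - k))) (snd \<omega> k) i)
      = (\<Sum>k=1..m. mv d (mpow d B (Suc m - k)) (snd \<omega> k) i)"
    by (intro sum.cong) (auto simp: Suc_diff_le simp del: mpow.simps)
  finally show ?case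
    using Suc.prems by (simp add: B_def[symmetric] mv_mat_id distrib_left del: mpow.simps(2))
qed

lemma normalized_eq:
  assumes A: "0 < \<alpha>" "\<alpha> \<le> \<beta>" "good_A \<alpha> \<beta> d A" and \<eta>: "0 < \<eta>" and i: "i < d"
  shows "mat_vec d (Sigma_inv_half d A) (Wn d A \<eta> n \<omega>) i
    = (\<Sum>k=1..n. snd \<omega> k i) / sqrt n + (fst \<omega> i - chain d A \<eta> \<omega> n i) / sqrt (2 * \<eta> * n)"
proof -
  have telescope: "\<eta> * (\<Sum>m<n. \<Sum>j<d. A i j * chain d A \<eta> \<omega> m j)
      = fst \<omega> i - chain d A \<eta> \<omega> n i + sqrt (2 * \<eta>) * (\<Sum>k=1..n. snd \<omega> k i)"
    using i by (induction n) (simp_all add: algebra_simps)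
  have "mat_vec d (Sigma_inv_half d A) (Wn d A \<eta> n \<omega>) i
      = (\<Sum>j<d. (A i j / sqrt 2) * (sqrt \<eta> / sqrt n * (\<Sum>m<n. chain d A \<eta> \<omega> m j)))"
    using i by (simp add: mat_vec_def Wn_def Sigma_inv_half_eq[OF A])
  also have "\<dots> = (sqrt \<eta> / (sqrt 2 * sqrt n)) * (\<Sum>j<d. \<Sum>m<n. A i j * chain d A \<eta> \<omega> m j)"
    by (simp add: sum_distrib_left mult_ac)
  also have "(\<Sum>j<d. \<Sum>m<n. A i j * chain d A \<eta> \<omega> m j) = (\<Sum>m<n. \<Sum>j<d. A i j * chain d A \<eta> \<omega> m j)"
    by (rule sum.swap)
  also have "\<dots> = (fst \<omega> i - chain d A \<eta> \<omega> n i + sqrt (2 * \<eta>) * (\<Sum>k=1..n. snd \<omega> k i)) / \<eta>"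
    using telescope \<eta> by (simp add: field_simps)
  also have "(sqrt \<eta> / (sqrt 2 * sqrt n)) * \<dots> = (sqrt \<eta> / (sqrt 2 * sqrt n * \<eta>)) * (fst \<omega> i - chain d A \<eta> \<omega> n i)
      + (sqrt \<eta> / (sqrt 2 * sqrt n * \<eta>) * (sqrt 2 * sqrt \<eta>)) * (\<Sum>k=1..n. snd \<omega> k i)"
    by (simp add: add_divide_distrib distrib_left real_sqrt_mult mult_ac)
  also have "sqrt \<eta> / (sqrt 2 * sqrt n * \<eta>) = 1 / sqrt (2 * \<eta> * n)"
  proof -
    have "sqrt \<eta> / (sqrt 2 * sqrt n * \<eta>) = (sqrt \<eta> / \<eta>) / (sqrt 2 * sqrt n)" by simp
    also have "\<dots> = 1 / sqrt (2 * \<eta> * n)"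
      using \<eta> by (simp add: sqrt_divide_self_eq real_sqrt_mult field_simps)
    finally show ?thesis .
  qed
  also have "1 / sqrt (2 * \<eta> * n) * (sqrt 2 * sqrt \<eta>) = 1 / sqrt n"
    using \<eta> by (simp add: real_sqrt_mult)
  finally show ?thesis by simp
qed

section \<open>Uniform control of the step matrix and the rate in n\<close>

text \<open>The form of I - \<eta> A lies between (1 - \<beta> \<eta>) |x|^2 and (1 - \<alpha>
  \<eta>) |x|^2; the last two hypotheses on \<open>r\<close> control its negative and positive
  extremes.\<close>

lemma op_bound_step_mat:
  assumes "good_A \<alpha> \<beta> d A" "0 \<le> \<eta>" "0 \<le> r" "1 - \<alpha> * \<eta> \<le> r" "\<beta> * \<eta> - 1 \<le> r"
  shows "op_bound d (step_mat d A \<eta>) r"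
proof (rule op_bound_symmetric)
  show "symmetric_mat d (step_mat d A \<eta>)"
    using assms(1) unfolding step_mat_def good_A_def by (intro symmetric_id_minus_scale) simp
  fix x
  have q: "quad d (step_mat d A \<eta>) x = dot d x x - \<eta> * quad d A x"
    unfolding step_mat_def by (rule quad_id_minus_scale)
  have "\<alpha> * dot d x x \<le> quad d A x" "quad d A x \<le> \<beta> * dot d x x"
    using assms(1) by (auto simp: good_A_def loewner_le_def quad_scale_id)
  then have "\<eta> * (\<alpha> * dot d x x) \<le> \<eta> * quad d A x" "\<eta> * quad d A x \<le> \<eta> * (\<beta> * dot d x x)"
    using assms(2) by (auto intro: mult_left_mono)
  moreover have "(1 - \<alpha> * \<eta>) * dot d x x \<le> r * dot d x x" "(\<beta> * \<eta> - 1) * dot d x x \<le> r * dot d x x"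
    using assms by (auto intro!: mult_right_mono dot_self_nonneg)
  ultimately show "\<bar>quad d (step_mat d A \<eta>) x\<bar> \<le> r * dot d x x"
    unfolding q by (simp add: algebra_simps abs_le_iff)
qed (rule assms)

text \<open>If \<open>\<eta> \<beta> > 1\<close> the chain need not contract, but then \<open>n \<le> \<beta>\<^sup>p\<close>.\<close>

lemma contraction_constants:
  fixes \<alpha> \<beta> p :: real
  assumes "0 < \<alpha>" "\<alpha> \<le> \<beta>" "1 < p"
  obtains D where "1 \<le> D" "\<And>\<eta>. 0 < \<eta> \<Longrightarrow> \<eta> \<le> 1 \<Longrightarrow> \<exists>r\<ge>0. 1 - \<alpha> * \<eta> \<le> r \<and> \<beta> * \<eta> - 1 \<le> r
      \<and> (\<forall>m \<le> nat \<lfloor>\<eta> powr (- p)\<rfloor>. r ^ m \<le> D) \<and> (\<Sum>m < nat \<lfloor>\<eta> powr (- p)\<rfloor>. r ^ m) \<le> D / \<eta>"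
proof -
  define N where "N = nat \<lfloor>\<beta> powr p\<rfloor>"
  \<comment> \<open>The summand 1 covers powers of a contraction, 1/\<alpha> their geometric sum,
    and the last summand the large steps, where at most \<open>N\<close> powers of 1 + \<beta>
    occur.\<close>
  define D where "D = 1 + 1 / \<alpha> + (1 + real N) * (1 + \<beta>) ^ N"
  have bN: "(1 + \<beta>) ^ N \<le> (1 + real N) * (1 + \<beta>) ^ N" "real N * (1 + \<beta>) ^ N \<le> (1 + real N) * (1 + \<beta>) ^ N"
    "0 \<le> (1 + \<beta>) ^ N"
    using assms by (auto simp: distrib_right)
  have "0 < 1 / \<alpha>" using assms by simp
  with bN have D: "1 \<le> D" "1 / \<alpha> \<le> D" "(1 + \<beta>) ^ N \<le> D" "real N * (1 + \<beta>) ^ N \<le> D"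
    unfolding D_def by linarith+
  show thesis
  proof
    fix \<eta> :: real assume \<eta>: "0 < \<eta>" "\<eta> \<le> 1"
    define n where "n = nat \<lfloor>\<eta> powr (- p)\<rfloor>"
    show "\<exists>r\<ge>0. 1 - \<alpha> * \<eta> \<le> r \<and> \<beta> * \<eta> - 1 \<le> r
      \<and> (\<forall>m \<le> nat \<lfloor>\<eta> powr (- p)\<rfloor>. r ^ m \<le> D) \<and> (\<Sum>m < nat \<lfloor>\<eta> powr (- p)\<rfloor>. r ^ m) \<le> D / \<eta>"
      unfolding n_def[symmetric]
    proof (cases "\<beta> * \<eta> \<le> 1")
      case True
      have "\<alpha> * \<eta> \<le> \<beta> * \<eta>" using assms \<eta> by simp
      define r where "r = 1 - \<alpha> * \<eta>"
      have "0 < \<alpha> * \<eta>" using assms \<eta> by simp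
      with True \<open>\<alpha> * \<eta> \<le> \<beta> * \<eta>\<close> have r: "0 \<le> r" "r < 1" unfolding r_def by linarith+
      have "(\<Sum>m<n. r ^ m) = (1 - r ^ n) / (1 - r)" using r by (simp add: sum_gp_strict)
      also have "\<dots> \<le> 1 / (1 - r)" using r by (intro divide_right_mono) auto
      also have "\<dots> = (1 / \<alpha>) / \<eta>" by (simp add: r_def)
      also have "\<dots> \<le> D / \<eta>" using D \<eta> by (intro divide_right_mono) auto
      finally have "(\<Sum>m<n. r ^ m) \<le> D / \<eta>" .
      moreover have "r ^ m \<le> D" for m using power_le_one[of r m] r D(1) by linarith
      ultimately show "\<exists>r\<ge>0. 1 - \<alpha> * \<eta> \<le> r \<and> \<beta> * \<eta> - 1 \<le> r \<and> (\<forall>m \<le> n. r ^ m \<le> D) \<and> (\<Sum>m < n. r ^ m) \<le> D / \<eta>"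
        using r True by (intro exI[of _ r]) (auto simp: r_def)
    next
      case False
      have "\<eta> powr (- p) \<le> \<beta> powr p"
      proof -
        have "1 / \<beta> \<le> \<eta>" using False assms by (simp add: field_simps)
        then have "1 / \<eta> \<le> \<beta>" using \<eta> assms by (simp add: field_simps)
        then have "(1 / \<eta>) powr p \<le> \<beta> powr p" using \<eta> assms by (intro powr_mono2) auto
        then show ?thesis using \<eta> by (simp add: powr_divide powr_minus_divide)
      qed
      then have nN: "n \<le> N" unfolding n_def N_def by (intro nat_mono floor_mono)
      \<comment> \<open>Here 1 + \<beta> serves as \<open>r\<close>: it bounds the step matrix for
        every \<eta> \<le> 1, and being at least 1 it has its largest relevant power at
        \<open>N\<close>.\<close>
      have pw: "(1 + \<beta>) ^ m \<le> (1 + \<beta>) ^ N" if "m \<le> n" for m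
        using that nN assms by (intro power_increasing) auto
      have "(\<Sum>m<n. (1 + \<beta>) ^ m) \<le> (\<Sum>m<n. (1 + \<beta>) ^ N)" by (intro sum_mono pw) auto
      also have "\<dots> \<le> real N * (1 + \<beta>) ^ N" using nN bN(3) by (simp add: mult_right_mono)
      also have "\<dots> \<le> D" by (rule D)
      also have "\<dots> \<le> D / \<eta>" using D(1) \<eta> by (simp add: field_simps)
      finally have "(\<Sum>m<n. (1 + \<beta>) ^ m) \<le> D / \<eta>" .
      moreover have "(1 + \<beta>) ^ m \<le> D" if "m \<le> n" for m using pw[OF that] D(3) by linarith
      moreover have "\<beta> * \<eta> \<le> \<beta> * 1" "0 \<le> \<alpha> * \<eta>" using assms \<eta> by (auto intro: mult_left_mono)
      then have "1 - \<alpha> * \<eta> \<le> 1 + \<beta>" "\<beta> * \<eta> - 1 \<le> 1 + \<beta>" using assms by linarith+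
      ultimately show "\<exists>r\<ge>0. 1 - \<alpha> * \<eta> \<le> r \<and> \<beta> * \<eta> - 1 \<le> r \<and> (\<forall>m \<le> n. r ^ m \<le> D) \<and> (\<Sum>m < n. r ^ m) \<le> D / \<eta>"
        using assms by (intro exI[of _ "1 + \<beta>"] conjI allI impI) linarith+
    qed
  qed (rule D(1))
qed

text \<open>Rounding down costs at most a factor 2, since \<eta>^(-p) \<le> n + 1 \<le> 2 n. Taking
  the p-th root gives 1/\<eta> \<le> 2 n^(1/p), as 2^(1/p) \<le> 2.\<close>

lemma steps_rate:
  fixes p \<eta> :: real
  assumes "1 < p" "0 < \<eta>" "\<eta> \<le> 1" and n: "n = nat \<lfloor>\<eta> powr (- p)\<rfloor>"
  shows "1 \<le> n" "1 / (\<eta> * n) \<le> 2 * real n powr (1 / p - 1)"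
proof -
  have "\<eta> powr p \<le> 1" using assms powr_mono2[of p \<eta> 1] by simp
  then have ge1: "1 \<le> \<eta> powr (- p)" using assms by (simp add: powr_minus_divide)
  then have "1 \<le> \<lfloor>\<eta> powr (- p)\<rfloor>" by simp
  then show n1: "1 \<le> n" unfolding n by linarith
  have "\<eta> powr (- p) \<le> real n + 1" unfolding n using \<open>1 \<le> \<lfloor>\<eta> powr (- p)\<rfloor>\<close> by linarith
  also have "\<dots> \<le> 2 * real n" using n1 by simp
  finally have "(\<eta> powr (- p)) powr (1 / p) \<le> (2 * real n) powr (1 / p)"
    using assms by (intro powr_mono2) auto
  moreover have "(\<eta> powr (- p)) powr (1 / p) = \<eta> powr (- 1)" using assms(1) by (simp add: powr_powr)
  moreover have "\<eta> powr (- 1) = 1 / \<eta>" using assms(2) by (simp add: powr_minus_divide)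
  ultimately have "1 / \<eta> \<le> 2 powr (1 / p) * real n powr (1 / p)"
    by (simp add: powr_mult)
  also have "\<dots> \<le> 2 powr 1 * real n powr (1 / p)"
    using assms by (intro mult_right_mono powr_mono) auto
  finally have "1 / \<eta> / n \<le> 2 * real n powr (1 / p) / n"
    by (intro divide_right_mono) auto
  then show "1 / (\<eta> * n) \<le> 2 * real n powr (1 / p - 1)"
    using n1 by (simp add: powr_diff mult.commute)
qed

lemma sum_reverse_steps: "(\<Sum>k=1..n. f (n - k)) = (\<Sum>m<n. f m)" for f :: "nat \<Rightarrow> real"
  using sum.nat_diff_reindex[of f n] by (simp add: sum.atLeast1_atMost_eq)

lemma measurable_chain:
  assumes "sets \<mu>0 = sets (Rd d)" "i < d"
  shows "(\<lambda>\<omega>. chain d A \<eta> \<omega> m i) \<in> borel_measurable (chain_space d \<mu>0)"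
  using assms(2)
proof (induction m arbitrary: i)
  case 0
  then show ?case by (simp add: measurable_fst_component assms)
next
  case (Suc m)
  have "(\<lambda>\<omega>. chain d A \<eta> \<omega> m i - \<eta> * (\<Sum>j<d. A i j * chain d A \<eta> \<omega> m j) + sqrt (2 * \<eta>) * snd \<omega> (Suc m) i)
      \<in> borel_measurable (chain_space d \<mu>0)"
    using Suc.prems
    by (intro borel_measurable_add borel_measurable_diff borel_measurable_times borel_measurable_sum
        measurable_const measurable_snd_component Suc.IH) auto
  then show ?case using Suc.prems by simp
qed

lemma measurable_normalized:
  assumes "sets \<mu>0 = sets (Rd d)"
  shows "(\<lambda>\<omega>. mat_vec d M (Wn d A \<eta> n \<omega>)) \<in> measurable (chain_space d \<mu>0) (Rd d)"
proof (rule measurable_into_Rd)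
  fix i assume "i < d"
  have "(\<lambda>\<omega>. \<Sum>j<d. M i j * (sqrt \<eta> / sqrt n * (\<Sum>m<n. chain d A \<eta> \<omega> m j))) \<in> borel_measurable (chain_space d \<mu>0)"
    by (intro borel_measurable_times borel_measurable_sum measurable_const measurable_chain assms) auto
  then show "(\<lambda>\<omega>. mat_vec d M (Wn d A \<eta> n \<omega>) i) \<in> borel_measurable (chain_space d \<mu>0)"
    using \<open>i < d\<close> by (simp add: mat_vec_def Wn_def)
qed (simp add: mat_vec_def)

section \<open>Synchronous coupling for a general initial law\<close>

text \<open>The coupling partner of the normalized average: driven by the same noise, it has exactly
  the standard Gaussian law.\<close>

definition noise_average :: "nat \<Rightarrow> nat \<Rightarrow> (nat \<Rightarrow> real) \<times> (nat \<Rightarrow> nat \<Rightarrow> real) \<Rightarrow> nat \<Rightarrow> real" where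
  "noise_average d n \<omega> = (\<lambda>i. if i < d then (\<Sum>k=1..n. snd \<omega> k i) / sqrt (real n) else undefined)"

lemma noise_average_law:
  assumes \<mu>0: "prob_space \<mu>0" "sets \<mu>0 = sets (Rd d)" and n: "1 \<le> n"
  shows "noise_average d n \<in> measurable (chain_space d \<mu>0) (Rd d)"
    "distr (chain_space d \<mu>0) (Rd d) (noise_average d n) = gauss d"
proof -
  define V where "V = noise_average d n"
  note V_def = V_def noise_average_def
  interpret P: prob_space \<mu>0 by fact
  interpret C: prob_space "chain_space d \<mu>0" by (rule prob_space_chain_space) fact
  interpret G: prob_space "gauss d" by (rule prob_space_gauss)
  have V: "V \<in> measurable (chain_space d \<mu>0) (Rd d)"
  proof (rule measurable_into_Rd)
    fix i assume "i < d"
    have "(\<lambda>\<omega>. (\<Sum>k=1..n. snd \<omega> k i) / sqrt n) \<in> borel_measurable (chain_space d \<mu>0)"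
      by (intro borel_measurable_divide borel_measurable_sum measurable_const measurable_snd_component \<open>i < d\<close>) auto
    then show "(\<lambda>\<omega>. V \<omega> i) \<in> borel_measurable (chain_space d \<mu>0)" using \<open>i < d\<close> by (simp add: V_def)
  qed (simp add: V_def)
  then show "noise_average d n \<in> measurable (chain_space d \<mu>0) (Rd d)" by (simp add: V_def(1))
  have "distr (chain_space d \<mu>0) (Rd d) V = gauss d"
  proof (rule char_unique_Rd)
    show "finite_measure (distr (chain_space d \<mu>0) (Rd d) V)"
      using C.prob_space_distr[OF V] by (simp add: prob_space_def)
    fix t :: "nat \<Rightarrow> real"
    have m2: "(\<lambda>x. \<Sum>j<d. t j * x j) \<in> borel_measurable (Rd d)"
      by (intro borel_measurable_sum borel_measurable_times) (auto simp: measurable_component_Rd)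
    have "(CLINT x|distr (chain_space d \<mu>0) (Rd d) V. iexp (\<Sum>j<d. t j * x j))
        = (CLINT \<omega>|chain_space d \<mu>0. iexp (\<Sum>j<d. t j * V \<omega> j))"
      by (rule integral_distr[OF V borel_measurable_iexp[OF m2]])
    also have "(\<lambda>\<omega>. \<Sum>j<d. t j * V \<omega> j)
        = (\<lambda>\<omega>. dot d (\<lambda>_. 0) (fst \<omega>) + (\<Sum>k=1..n. \<Sum>j<d. (1 / sqrt n * t j) * snd \<omega> k j))"
    proof
      fix \<omega> :: "(nat \<Rightarrow> real) \<times> (nat \<Rightarrow> nat \<Rightarrow> real)"
      have "(\<Sum>j<d. t j * V \<omega> j) = (\<Sum>j<d. \<Sum>k=1..n. (1 / sqrt n * t j) * snd \<omega> k j)"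
        by (intro sum.cong refl) (simp add: V_def sum_distrib_left sum_divide_distrib)
      also have "\<dots> = (\<Sum>k=1..n. \<Sum>j<d. (1 / sqrt n * t j) * snd \<omega> k j)" by (rule sum.swap)
      finally show "(\<Sum>j<d. t j * V \<omega> j)
          = dot d (\<lambda>_. 0) (fst \<omega>) + (\<Sum>k=1..n. \<Sum>j<d. (1 / sqrt n * t j) * snd \<omega> k j)"
        by (simp add: dot_def)
    qed
    also have "(CLINT \<omega>|chain_space d \<mu>0. iexp (dot d (\<lambda>_. 0) (fst \<omega>) + (\<Sum>k=1..n. \<Sum>j<d. (1 / sqrt n * t j) * snd \<omega> k j)))
        = complex_of_real (exp (- (\<Sum>k=1..n. dot d (\<lambda>j. 1 / sqrt n * t j) (\<lambda>j. 1 / sqrt n * t j)) / 2))"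
      unfolding chain_space_char[OF \<mu>0 finite_atLeastAtMost] using P.prob_space by (simp add: dot_def)
    also have "(\<Sum>k=1..n. dot d (\<lambda>j. 1 / sqrt n * t j) (\<lambda>j. 1 / sqrt n * t j)) = dot d t t"
      using n by (simp only: dot_linear) simp
    finally show "(CLINT x|distr (chain_space d \<mu>0) (Rd d) V. iexp (\<Sum>j<d. t j * x j))
        = (CLINT x|gauss d. iexp (\<Sum>j<d. t j * x j))"
      by (simp only: gauss_char)
  qed (simp_all add: G.finite_measure_axioms sets_gauss)
  then show "distr (chain_space d \<mu>0) (Rd d) (noise_average d n) = gauss d" by (simp add: V_def(1))
qed

lemma nn_integral_chain_space_fst:
  assumes "sets \<mu>0 = sets (Rd d)"
  shows "(\<integral>\<^sup>+\<omega>. ennreal (dot d (fst \<omega>) (fst \<omega>)) \<partial>chain_space d \<mu>0) = (\<integral>\<^sup>+x. ennreal (\<Sum>i<d. (x i)\<^sup>2) \<partial>\<mu>0)"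
proof -
  interpret M: prob_space "PiM UNIV (\<lambda>_::nat. gauss d)" by (intro prob_space_PiM prob_space_gauss)
  have m: "(\<lambda>x. \<Sum>i<d. (x i)\<^sup>2) \<in> borel_measurable \<mu>0"
    by (intro borel_measurable_sum borel_measurable_power)
      (auto simp: measurable_component_Rd assms cong: measurable_cong_sets)
  have "(\<integral>\<^sup>+x. ennreal (\<Sum>i<d. (x i)\<^sup>2) \<partial>\<mu>0) = (\<integral>\<^sup>+x. ennreal (\<Sum>i<d. (x i)\<^sup>2) \<partial>distr (chain_space d \<mu>0) \<mu>0 fst)"
    unfolding chain_space_def by (simp add: M.distr_pair_fst)
  also have "\<dots> = (\<integral>\<^sup>+\<omega>. ennreal (\<Sum>i<d. (fst \<omega> i)\<^sup>2) \<partial>chain_space d \<mu>0)"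
    unfolding chain_space_def using m by (intro nn_integral_distr) auto
  finally show ?thesis by (simp add: dot_def power2_eq_square)
qed

lemma ennreal_lincomb:
  "0 \<le> a \<Longrightarrow> 0 \<le> x \<Longrightarrow> 0 \<le> b \<Longrightarrow> 0 \<le> y
    \<Longrightarrow> ennreal (a * x + b * y) = ennreal a * ennreal x + ennreal b * ennreal y"
  by (simp add: ennreal_mult)

text \<open>The pathwise cost is |X_0 - X_n|^2 / (2 \<eta> n). The initial state contributes O(d) to
  the second moment of the numerator. The accumulated noise \<open>E\<close> has second moment O(d /
  \<eta>), but it enters with the factor sqrt (2 \<eta>), so its contribution is O(d) as
  well.\<close>

lemma W2_sq_normalized_le:
  assumes A: "0 < \<alpha>" "\<alpha> \<le> \<beta>" "good_A \<alpha> \<beta> d A" and \<eta>: "0 < \<eta>" and n: "1 \<le> n"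
    and \<mu>0: "prob_space \<mu>0" "sets \<mu>0 = sets (Rd d)"
    and c0: "0 \<le> c0" "(\<integral>\<^sup>+ x. ennreal (\<Sum>i<d. (x i)\<^sup>2) \<partial>\<mu>0) \<le> ennreal (c0 * real d)"
    and r: "op_bound d (step_mat d A \<eta>) r" and D: "\<And>m. m \<le> n \<Longrightarrow> r ^ m \<le> D" "(\<Sum>m<n. r ^ m) \<le> D / \<eta>"
  shows "W2_sq d (normalized_law d A \<eta> n \<mu>0) (gauss d)
    \<le> ennreal (real d * ((2 + 2 * D\<^sup>2) * c0 + 2 * D\<^sup>2) / (\<eta> * n))"
proof -
  define B where "B = step_mat d A \<eta>"
  define \<Omega> where "\<Omega> = chain_space d \<mu>0"
  define U where "U = (\<lambda>\<omega>. mat_vec d (Sigma_inv_half d A) (Wn d A \<eta> n \<omega>))"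
  define V where "V = noise_average d n"
  \<comment> \<open>X_0 - X_n is split into (I - B^n) X_0, controlled by the moment hypothesis, and
    the noise accumulated up to time \<open>n\<close>.\<close>
  define X where "X \<omega> = (\<lambda>i. fst \<omega> i - mv d (mpow d B n) (fst \<omega>) i)" for \<omega> :: "(nat \<Rightarrow> real) \<times> (nat \<Rightarrow> nat \<Rightarrow> real)"
  define E where "E \<omega> = (\<lambda>i. \<Sum>k=1..n. \<Sum>j<d. mpow d B (n - k) i j * snd \<omega> k j)" for \<omega> :: "(nat \<Rightarrow> real) \<times> (nat \<Rightarrow> nat \<Rightarrow> real)"
  have rB: "op_bound d (mpow d B m) (r ^ m)" for m unfolding B_def by (rule op_bound_mpow[OF r])
  have r0: "0 \<le> r" by (rule op_bound_nonneg[OF r])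
  have D0: "0 \<le> D" using D(1)[of 0] by simp
  have sqD: "(r ^ m)\<^sup>2 \<le> D\<^sup>2" if "m \<le> n" for m using D(1)[OF that] r0 by (intro power_mono) auto
  have diff: "U \<omega> i - V \<omega> i = 1 / sqrt (2 * \<eta> * n) * (X \<omega> i - sqrt (2 * \<eta>) * E \<omega> i)" if "i < d" for \<omega> i
    using that unfolding U_def V_def normalized_eq[OF A \<eta> that] chain_eq[OF that]
    by (simp add: X_def E_def B_def mv_def noise_average_def)
  have Xle: "dot d (X \<omega>) (X \<omega>) \<le> (2 + 2 * D\<^sup>2) * dot d (fst \<omega>) (fst \<omega>)" for \<omega>
  proof -
    have "dot d (X \<omega>) (X \<omega>) \<le> 2 * dot d (fst \<omega>) (fst \<omega>)
        + 2 * dot d (mv d (mpow d B n) (fst \<omega>)) (mv d (mpow d B n) (fst \<omega>))"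
      unfolding X_def by (rule dot_diff_self_le)
    also have "dot d (mv d (mpow d B n) (fst \<omega>)) (mv d (mpow d B n) (fst \<omega>)) \<le> (r ^ n)\<^sup>2 * dot d (fst \<omega>) (fst \<omega>)"
      by (rule op_boundD[OF rB])
    also have "\<dots> \<le> D\<^sup>2 * dot d (fst \<omega>) (fst \<omega>)"
      using sqD by (intro mult_right_mono dot_self_nonneg) auto
    finally show ?thesis by (simp add: algebra_simps)
  qed
  have cost: "(\<Sum>i<d. (U \<omega> i - V \<omega> i)\<^sup>2) \<le> (2 + 2 * D\<^sup>2) / (\<eta> * n) * dot d (fst \<omega>) (fst \<omega>) + 2 / n * dot d (E \<omega>) (E \<omega>)" for \<omega>
  proof -
    have "(\<Sum>i<d. (U \<omega> i - V \<omega> i)\<^sup>2) = 1 / (2 * \<eta> * n) * dot d (\<lambda>i. X \<omega> i - sqrt (2 * \<eta>) * E \<omega> i) (\<lambda>i. X \<omega> i - sqrt (2 * \<eta>) * E \<omega> i)"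
      using \<eta> unfolding dot_def sum_distrib_left
      by (intro sum.cong refl) (simp add: diff power_mult_distrib power_divide, simp add: power2_eq_square)
    also have "\<dots> \<le> 1 / (2 * \<eta> * n) * (2 * dot d (X \<omega>) (X \<omega>) + 2 * dot d (\<lambda>i. sqrt (2 * \<eta>) * E \<omega> i) (\<lambda>i. sqrt (2 * \<eta>) * E \<omega> i))"
      using \<eta> by (intro mult_left_mono dot_diff_self_le) auto
    also have "dot d (\<lambda>i. sqrt (2 * \<eta>) * E \<omega> i) (\<lambda>i. sqrt (2 * \<eta>) * E \<omega> i) = 2 * \<eta> * dot d (E \<omega>) (E \<omega>)"
      using \<eta> by (simp add: dot_linear flip: mult.assoc)
    also have "1 / (2 * \<eta> * n) * (2 * dot d (X \<omega>) (X \<omega>) + 2 * (2 * \<eta> * dot d (E \<omega>) (E \<omega>)))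
        = 1 / (\<eta> * n) * dot d (X \<omega>) (X \<omega>) + 2 / n * dot d (E \<omega>) (E \<omega>)"
      using \<eta> n by (simp add: field_simps)
    also have "1 / (\<eta> * n) * dot d (X \<omega>) (X \<omega>) \<le> 1 / (\<eta> * n) * ((2 + 2 * D\<^sup>2) * dot d (fst \<omega>) (fst \<omega>))"
      using \<eta> by (intro mult_left_mono Xle) auto
    finally show ?thesis by simp
  qed
  have Em: "(\<lambda>\<omega>. dot d (E \<omega>) (E \<omega>)) \<in> borel_measurable \<Omega>"
    unfolding dot_def E_def \<Omega>_def
    by (intro borel_measurable_times borel_measurable_sum measurable_const measurable_snd_component) auto
  have Fm: "(\<lambda>\<omega>. dot d (fst \<omega>) (fst \<omega>)) \<in> borel_measurable \<Omega>"
    unfolding dot_def \<Omega>_def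
    by (intro borel_measurable_times borel_measurable_sum measurable_fst_component \<mu>0) auto
  have "(\<integral>\<^sup>+\<omega>. ennreal (dot d (E \<omega>) (E \<omega>)) \<partial>\<Omega>) = ennreal (\<Sum>i<d. \<Sum>k=1..n. \<Sum>j<d. (mpow d B (n - k) i j)\<^sup>2)"
    using noise_linear_second_moment[OF \<mu>0, of "{1..n}" "\<lambda>k. mpow d B (n - k)"]
    by (simp add: \<Omega>_def E_def dot_def power2_eq_square)
  also have "(\<Sum>i<d. \<Sum>k=1..n. \<Sum>j<d. (mpow d B (n - k) i j)\<^sup>2) = (\<Sum>k=1..n. \<Sum>i<d. \<Sum>j<d. (mpow d B (n - k) i j)\<^sup>2)"
    by (rule sum.swap)
  also have "\<dots> = (\<Sum>m<n. \<Sum>i<d. \<Sum>j<d. (mpow d B m i j)\<^sup>2)" by (rule sum_reverse_steps)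
  \<comment> \<open>Of the two factors r^m one is replaced by \<open>D\<close>, so that the bound on
    the sum of the first powers applies.\<close>
  also have "\<dots> \<le> (\<Sum>m<n. real d * (D * r ^ m))"
  proof (rule sum_mono)
    fix m assume "m \<in> {..<n}"
    have "(\<Sum>i<d. \<Sum>j<d. (mpow d B m i j)\<^sup>2) \<le> real d * (r ^ m)\<^sup>2" by (rule op_bound_sum_squares[OF rB])
    also have "\<dots> \<le> real d * (D * r ^ m)"
      unfolding power2_eq_square using D(1)[of m] \<open>m \<in> {..<n}\<close> r0 by (intro mult_left_mono mult_right_mono) auto
    finally show "(\<Sum>i<d. \<Sum>j<d. (mpow d B m i j)\<^sup>2) \<le> real d * (D * r ^ m)" .
  qed
  also have "\<dots> = real d * D * (\<Sum>m<n. r ^ m)" by (simp add: sum_distrib_left mult.assoc)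
  also have "\<dots> \<le> real d * D * (D / \<eta>)" using D0 by (intro mult_left_mono D) auto
  finally have EI: "(\<integral>\<^sup>+\<omega>. ennreal (dot d (E \<omega>) (E \<omega>)) \<partial>\<Omega>) \<le> ennreal (real d * D * (D / \<eta>))"
    by (simp add: ennreal_leI)
  have FI: "(\<integral>\<^sup>+\<omega>. ennreal (dot d (fst \<omega>) (fst \<omega>)) \<partial>\<Omega>) \<le> ennreal (c0 * real d)"
    unfolding \<Omega>_def nn_integral_chain_space_fst[OF \<mu>0(2)] by (rule c0)
  have k1: "0 \<le> (2 + 2 * D\<^sup>2) / (\<eta> * n)" using \<eta> by simp
  have "W2_sq d (normalized_law d A \<eta> n \<mu>0) (gauss d) \<le> (\<integral>\<^sup>+\<omega>. ennreal (\<Sum>i<d. (U \<omega> i - V \<omega> i)\<^sup>2) \<partial>\<Omega>)"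
    using W2_sq_le[OF prob_space_chain_space[OF \<mu>0(1), of d] measurable_normalized[OF \<mu>0(2)] noise_average_law(1)[OF \<mu>0 n],
        of "Sigma_inv_half d A" A \<eta> n]
    unfolding noise_average_law(2)[OF \<mu>0 n] normalized_law_def U_def V_def \<Omega>_def .
  also have "\<dots> \<le> (\<integral>\<^sup>+\<omega>. ennreal ((2 + 2 * D\<^sup>2) / (\<eta> * n)) * ennreal (dot d (fst \<omega>) (fst \<omega>))
      + ennreal (2 / n) * ennreal (dot d (E \<omega>) (E \<omega>)) \<partial>\<Omega>)"
  proof (rule nn_integral_mono)
    fix \<omega>
    have "ennreal ((2 + 2 * D\<^sup>2) / (\<eta> * n) * dot d (fst \<omega>) (fst \<omega>) + 2 / n * dot d (E \<omega>) (E \<omega>))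
        = ennreal ((2 + 2 * D\<^sup>2) / (\<eta> * n)) * ennreal (dot d (fst \<omega>) (fst \<omega>)) + ennreal (2 / n) * ennreal (dot d (E \<omega>) (E \<omega>))"
      by (rule ennreal_lincomb[OF k1 dot_self_nonneg _ dot_self_nonneg]) simp
    then show "ennreal (\<Sum>i<d. (U \<omega> i - V \<omega> i)\<^sup>2)
        \<le> ennreal ((2 + 2 * D\<^sup>2) / (\<eta> * n)) * ennreal (dot d (fst \<omega>) (fst \<omega>)) + ennreal (2 / n) * ennreal (dot d (E \<omega>) (E \<omega>))"
      using ennreal_leI[OF cost[of \<omega>]] by metis
  qed
  also have "\<dots> = ennreal ((2 + 2 * D\<^sup>2) / (\<eta> * n)) * (\<integral>\<^sup>+\<omega>. ennreal (dot d (fst \<omega>) (fst \<omega>)) \<partial>\<Omega>)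
      + ennreal (2 / n) * (\<integral>\<^sup>+\<omega>. ennreal (dot d (E \<omega>) (E \<omega>)) \<partial>\<Omega>)"
    using Em Fm by (simp add: nn_integral_add nn_integral_cmult)
  also have "\<dots> \<le> ennreal ((2 + 2 * D\<^sup>2) / (\<eta> * n)) * ennreal (c0 * real d)
      + ennreal (2 / n) * ennreal (real d * D * (D / \<eta>))"
    by (intro add_mono mult_left_mono EI FI) auto
  also have "\<dots> = ennreal ((2 + 2 * D\<^sup>2) / (\<eta> * n) * (c0 * real d) + 2 / n * (real d * D * (D / \<eta>)))"
    using k1 c0 D0 \<eta> by (intro ennreal_lincomb[symmetric]) auto
  also have "(2 + 2 * D\<^sup>2) / (\<eta> * n) * (c0 * real d) + 2 / n * (real d * D * (D / \<eta>))
      = real d * ((2 + 2 * D\<^sup>2) * c0 + 2 * D\<^sup>2) / (\<eta> * n)"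
    using \<eta> n by (simp add: field_simps power2_eq_square)
  finally show ?thesis .
qed

section \<open>Covariance comparison for a Gaussian initial law\<close>

text \<open>All reduces to bounding the form of S - I by \<open>e\<close>. Since \<open>e\<close>
  enters the squared distance as e^2, the distance is linear in 1 / (\<eta> n), where the pathwise
  coupling yields only its square root.\<close>

lemma W2_sq_normalized_gaussian_le:
  assumes A: "0 < \<alpha>" "\<alpha> \<le> \<beta>" "good_A \<alpha> \<beta> d A" and \<eta>: "0 < \<eta>" and n: "1 \<le> n"
    and S0: "pos_def d \<Sigma>0" "loewner_le d \<Sigma>0 (scal_id d c1)" and c1: "0 \<le> c1"
    and r: "op_bound d (step_mat d A \<eta>) r" and D: "\<And>m. m \<le> n \<Longrightarrow> r ^ m \<le> D" "(\<Sum>m<n. r ^ m) \<le> D / \<eta>"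
  shows "W2_sq d (normalized_law d A \<eta> n (gaussian_law d \<Sigma>0)) (gauss d)
    \<le> ennreal (real d * ((c1 * (1 + D\<^sup>2) + (2 + D) * D) / (\<eta> * n))\<^sup>2)"
proof -
  define B where "B = step_mat d A \<eta>"
  \<comment> \<open>G m = I - B^m is the net coefficient of noise that entered m steps before the
    end. The factor 1 matches the shape I - c M of the earlier lemmas.\<close>
  define G where "G m = (\<lambda>i j. mat_id d i j - 1 * mpow d B m i j)" for m
  define c where "c = 1 / sqrt (2 * \<eta> * n)"
  define \<mu>0 where "\<mu>0 = gaussian_law d \<Sigma>0"
  define \<Omega> where "\<Omega> = chain_space d \<mu>0"
  define U where "U = (\<lambda>\<omega>. mat_vec d (Sigma_inv_half d A) (Wn d A \<eta> n \<omega>))"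
  \<comment> \<open>The identity between the two factors gives the noise terms the same conjugation
    shape as the initial covariance, so symmetry and form follow from the same lemmas.\<close>
  define S where "S = (\<lambda>i j. c\<^sup>2 * mat_mult d (G n) (mat_mult d \<Sigma>0 (G n)) i j
    + (1 / n) * (\<Sum>k=1..n. mat_mult d (G (n - k)) (mat_mult d (mat_id d) (G (n - k))) i j))"
  have psd0: "psd d \<Sigma>0"
    unfolding psd_def
  proof (intro conjI allI)
    show "symmetric_mat d \<Sigma>0" using S0(1) by (simp add: pos_def_def)
    show "0 \<le> quad d \<Sigma>0 x" for x
    proof (cases "\<exists>i<d. x i \<noteq> 0")
      case True
      then show ?thesis using S0(1) by (simp add: pos_def_def less_imp_le)
    qed (simp add: quad_def)
  qed
  have rB: "op_bound d (mpow d B m) (r ^ m)" for m unfolding B_def by (rule op_bound_mpow[OF r])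
  have r0: "0 \<le> r" by (rule op_bound_nonneg[OF r])
  have D0: "0 \<le> D" using D(1)[of 0] by simp
  have symB: "symmetric_mat d B"
    using A(3) unfolding B_def step_mat_def good_A_def by (intro symmetric_id_minus_scale) simp
  have symG: "symmetric_mat d (G m)" for m
    unfolding G_def by (intro symmetric_id_minus_scale symmetric_mpow symB)
  have mvG: "mv d (G m) x i = x i - mv d (mpow d B m) x i" if "i < d" for m x i
    using mv_id_minus_scale[OF that, of 1] by (simp add: G_def)
  have c2: "c\<^sup>2 = 1 / (2 * \<eta> * n)" using \<eta> by (simp add: c_def power_divide)
  have cs: "c * sqrt (2 * \<eta>) = 1 / sqrt n" using \<eta> by (simp add: c_def real_sqrt_mult)
  have quadS: "quad d S t = c\<^sup>2 * quad d \<Sigma>0 (mv d (G n) t)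
      + (1 / n) * (\<Sum>k=1..n. dot d (mv d (G (n - k)) t) (mv d (G (n - k)) t))" for t
  proof -
    have "quad d (mat_id d) x = dot d x x" for x
      unfolding quad_dot by (intro dot_cong) (auto simp: mv_mat_id)
    then show ?thesis unfolding S_def quad_add quad_scale quad_sum quad_conj[OF symG] by simp
  qed
  have symS: "symmetric_mat d S"
    using symmetric_conj[OF symG[of n], of \<Sigma>0] symmetric_conj[OF symG symmetric_mat_id] psd0
    by (simp add: S_def symmetric_mat_def psd_def)
  have psdS: "psd d S"
    using symS psd0 by (auto simp: psd_def quadS intro!: add_nonneg_nonneg mult_nonneg_nonneg divide_nonneg_nonneg sum_nonneg dot_self_nonneg)
  have R: "mat_vec d (mat_sqrt d \<Sigma>0) \<in> measurable (gauss d) (Rd d)"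
    using measurable_mat_vec by (simp cong: measurable_cong_sets add: sets_gauss)
  have \<mu>0: "prob_space \<mu>0" "sets \<mu>0 = sets (Rd d)"
    using prob_space.prob_space_distr[OF prob_space_gauss R] by (auto simp: \<mu>0_def gaussian_law_def)
  have Ueq: "U \<omega> i = c * mv d (G n) (fst \<omega>) i + (\<Sum>k=1..n. 1 / sqrt n * mv d (G (n - k)) (snd \<omega> k) i)"
    if "i < d" for \<omega> i
  proof -
    define b where "b = (\<Sum>k=1..n. mv d (mpow d B (n - k)) (snd \<omega> k) i)"
    have "U \<omega> i = (\<Sum>k=1..n. snd \<omega> k i) / sqrt n + c * (fst \<omega> i - (mv d (mpow d B n) (fst \<omega>) i + sqrt (2 * \<eta>) * b))"
      unfolding U_def normalized_eq[OF A \<eta> that] chain_eq[OF that] by (simp add: b_def B_def c_def)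
    also have "\<dots> = c * (fst \<omega> i - mv d (mpow d B n) (fst \<omega>) i)
        + (\<Sum>k=1..n. snd \<omega> k i) / sqrt n - (c * sqrt (2 * \<eta>)) * b"
      by (simp add: algebra_simps)
    also have "\<dots> = c * mv d (G n) (fst \<omega>) i + 1 / sqrt n * ((\<Sum>k=1..n. snd \<omega> k i) - b)"
      unfolding cs mvG[OF that] by (simp add: diff_divide_distrib)
    also have "(\<Sum>k=1..n. snd \<omega> k i) - b = (\<Sum>k=1..n. mv d (G (n - k)) (snd \<omega> k) i)"
      by (simp add: b_def mvG[OF that] sum_subtractf)
    finally show ?thesis by (simp only: sum_distrib_left)
  qed
  have char: "(CLINT \<omega>|\<Omega>. iexp (\<Sum>j<d. t j * U \<omega> j)) = complex_of_real (exp (- quad d S t / 2))" for t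
  proof -
    \<comment> \<open>Symmetry of \<open>G m\<close> moves it from the random vectors onto
      \<open>t\<close>; the exponent becomes a fixed linear form in the initial state and the
      noise.\<close>
    define a where "a = (\<lambda>i. c * mv d (G n) t i)"
    define u where "u k = (\<lambda>i. 1 / sqrt n * mv d (G (n - k)) t i)" for k
    have lin: "(\<Sum>j<d. t j * U \<omega> j) = dot d a (fst \<omega>) + (\<Sum>k=1..n. \<Sum>j<d. u k j * snd \<omega> k j)" for \<omega>
    proof -
      have "(\<Sum>j<d. t j * U \<omega> j) = dot d t (\<lambda>i. c * mv d (G n) (fst \<omega>) i + (\<Sum>k=1..n. 1 / sqrt n * mv d (G (n - k)) (snd \<omega> k) i))"
        by (simp add: dot_def Ueq)
      also have "\<dots> = c * dot d t (mv d (G n) (fst \<omega>)) + dot d t (\<lambda>i. \<Sum>k=1..n. 1 / sqrt n * mv d (G (n - k)) (snd \<omega> k) i)"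
        by (simp only: dot_linear)
      also have "dot d t (\<lambda>i. \<Sum>k=1..n. 1 / sqrt n * mv d (G (n - k)) (snd \<omega> k) i)
          = (\<Sum>k=1..n. dot d t (\<lambda>i. 1 / sqrt n * mv d (G (n - k)) (snd \<omega> k) i))"
        unfolding dot_def sum_distrib_left by (rule sum.swap)
      also have "\<dots> = (\<Sum>k=1..n. dot d (u k) (snd \<omega> k))"
        unfolding u_def dot_linear dot_mv_symmetric[OF symG] ..
      also have "c * dot d t (mv d (G n) (fst \<omega>)) = dot d a (fst \<omega>)"
        unfolding a_def dot_linear dot_mv_symmetric[OF symG] ..
      finally show ?thesis by (simp add: dot_def)
    qed
    have "(CLINT x|\<mu>0. iexp (dot d a x)) = complex_of_real (exp (- quad d \<Sigma>0 a / 2))"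
      using gaussian_law_char[OF psd0, of a] unfolding \<mu>0_def dot_def .
    then have "(CLINT \<omega>|\<Omega>. iexp (\<Sum>j<d. t j * U \<omega> j))
        = complex_of_real (exp (- quad d \<Sigma>0 a / 2)) * complex_of_real (exp (- (\<Sum>k=1..n. dot d (u k) (u k)) / 2))"
      unfolding lin \<Omega>_def chain_space_char[OF \<mu>0 finite_atLeastAtMost] by simp
    also have "\<dots> = complex_of_real (exp (- (quad d \<Sigma>0 a + (\<Sum>k=1..n. dot d (u k) (u k))) / 2))"
      by (simp add: exp_add[symmetric] add_divide_distrib flip: of_real_mult)
    also have "quad d \<Sigma>0 a = c\<^sup>2 * quad d \<Sigma>0 (mv d (G n) t)"
      by (simp add: a_def quad_dot mv_linear dot_linear power2_eq_square)
    also have "(\<Sum>k=1..n. dot d (u k) (u k)) = (1 / n) * (\<Sum>k=1..n. dot d (mv d (G (n - k)) t) (mv d (G (n - k)) t))"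
      unfolding u_def dot_linear by (simp add: sum_divide_distrib)
    finally show ?thesis unfolding quadS .
  qed
  \<comment> \<open>With c^2 = 1 / (2 \<eta> n), the initial covariance contributes c^2 c1 (2 + 2
    D^2). Noise contributes at most (2 + D) r^m for each m, and these terms sum to (2 + D) D /
    \<eta> before division by \<open>n\<close>.\<close>
  define e where "e = (c1 * (1 + D\<^sup>2) + (2 + D) * D) / (\<eta> * n)"
  have bound: "\<bar>quad d S t - dot d t t\<bar> \<le> e * dot d t t" for t
  proof -
    define T where "T = dot d t t"
    have T0: "0 \<le> T" by (simp add: T_def dot_self_nonneg)
    \<comment> \<open>The deviation caused by one noise term: |(I - B^m) t|^2 - |t|^2 = |B^m t|^2 -
      2 <t, B^m t>, and both parts are of order r^m.\<close>
    define p where "p m = dot d (mv d (G m) t) (mv d (G m) t) - T" for m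
    have Bt: "dot d (mv d (mpow d B m) t) (mv d (mpow d B m) t) \<le> D * r ^ m * T" if "m \<le> n" for m
    proof -
      have "dot d (mv d (mpow d B m) t) (mv d (mpow d B m) t) \<le> (r ^ m)\<^sup>2 * T"
        unfolding T_def by (rule op_boundD[OF rB])
      also have "\<dots> \<le> D * r ^ m * T"
        unfolding power2_eq_square using D(1)[OF that] r0 T0 by (intro mult_right_mono) auto
      finally show ?thesis .
    qed
    have p: "\<bar>p m\<bar> \<le> (2 + D) * T * r ^ m" if "m \<le> n" for m
    proof -
      have "dot d (mv d (G m) t) (mv d (G m) t)
          = dot d (\<lambda>i. t i - mv d (mpow d B m) t i) (\<lambda>i. t i - mv d (mpow d B m) t i)"
        by (intro dot_cong) (simp_all add: mvG)
      then have "p m = dot d (mv d (mpow d B m) t) (mv d (mpow d B m) t) - 2 * quad d (mpow d B m) t"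
        by (simp add: p_def dot_linear T_def quad_dot dot_commute[of d "mv d (mpow d B m) t" t])
      moreover have "\<bar>quad d (mpow d B m) t\<bar> \<le> r ^ m * T" unfolding T_def by (rule quad_op_bound[OF rB])
      moreover have "0 \<le> dot d (mv d (mpow d B m) t) (mv d (mpow d B m) t)" by (rule dot_self_nonneg)
      ultimately have "\<bar>p m\<bar> \<le> D * r ^ m * T + 2 * (r ^ m * T)" using Bt[OF that] by linarith
      then show ?thesis by (simp add: algebra_simps)
    qed
    have "(\<Sum>k=1..n. dot d (mv d (G (n - k)) t) (mv d (G (n - k)) t)) = (\<Sum>k=1..n. T + p (n - k))"
      by (simp add: p_def)
    also have "\<dots> = n * T + (\<Sum>m<n. p m)"
      using sum_reverse_steps[of p n] by (simp add: sum.distrib)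
    finally have "quad d S t - T = c\<^sup>2 * quad d \<Sigma>0 (mv d (G n) t) + (1 / n) * (\<Sum>m<n. p m)"
      using n by (simp add: quadS distrib_left add_divide_distrib)
    moreover have "\<bar>(1 / n) * (\<Sum>m<n. p m)\<bar> \<le> (1 / n) * ((2 + D) * T * (D / \<eta>))"
    proof -
      have "\<bar>\<Sum>m<n. p m\<bar> \<le> (\<Sum>m<n. \<bar>p m\<bar>)" by (rule sum_abs)
      also have "\<dots> \<le> (\<Sum>m<n. (2 + D) * T * r ^ m)" by (intro sum_mono p) auto
      also have "\<dots> = (2 + D) * T * (\<Sum>m<n. r ^ m)" by (simp add: sum_distrib_left)
      also have "\<dots> \<le> (2 + D) * T * (D / \<eta>)" using D0 T0 by (intro mult_left_mono D) auto
      finally have "(1 / n) * \<bar>\<Sum>m<n. p m\<bar> \<le> (1 / n) * ((2 + D) * T * (D / \<eta>))" by (intro mult_left_mono) auto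
      moreover have "\<bar>(1 / n) * (\<Sum>m<n. p m)\<bar> = (1 / n) * \<bar>\<Sum>m<n. p m\<bar>"
        unfolding abs_mult by simp
      ultimately show ?thesis by simp
    qed
    moreover have "0 \<le> c\<^sup>2 * quad d \<Sigma>0 (mv d (G n) t)" using psd0 by (simp add: psd_def)
    moreover have "c\<^sup>2 * quad d \<Sigma>0 (mv d (G n) t) \<le> c\<^sup>2 * (c1 * (2 * T + 2 * (D\<^sup>2 * T)))"
    proof (rule mult_left_mono)
      have "quad d \<Sigma>0 (mv d (G n) t) \<le> c1 * dot d (mv d (G n) t) (mv d (G n) t)"
        using S0(2) by (simp add: loewner_le_def quad_scale_id)
      also have "dot d (mv d (G n) t) (mv d (G n) t)
          = dot d (\<lambda>i. t i - mv d (mpow d B n) t i) (\<lambda>i. t i - mv d (mpow d B n) t i)"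
        by (intro dot_cong) (simp_all add: mvG)
      also have "\<dots> \<le> 2 * T + 2 * dot d (mv d (mpow d B n) t) (mv d (mpow d B n) t)"
        unfolding T_def by (rule dot_diff_self_le)
      also have "dot d (mv d (mpow d B n) t) (mv d (mpow d B n) t) \<le> D * r ^ n * T" by (rule Bt) simp
      also have "D * r ^ n * T \<le> D * D * T" using D(1)[of n] D0 T0 by (intro mult_right_mono mult_left_mono) auto
      finally show "quad d \<Sigma>0 (mv d (G n) t) \<le> c1 * (2 * T + 2 * (D\<^sup>2 * T))"
        using c1 by (simp add: power2_eq_square mult_left_mono)
    qed simp
    ultimately have "\<bar>quad d S t - T\<bar> \<le> c\<^sup>2 * (c1 * (2 * T + 2 * (D\<^sup>2 * T))) + (1 / n) * ((2 + D) * T * (D / \<eta>))"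
      by linarith
    also have "\<dots> = e * T"
    proof -
      define q where "q = 1 / (\<eta> * n)"
      have "c\<^sup>2 = q / 2" "(1 / n) * ((2 + D) * T * (D / \<eta>)) = (2 + D) * T * D * q"
        "e = (c1 * (1 + D\<^sup>2) + (2 + D) * D) * q"
        by (simp_all add: c2 q_def e_def)
      then show ?thesis by (simp add: algebra_simps)
    qed
    finally show ?thesis by (simp add: T_def)
  qed
  have e0: "0 \<le> e" using c1 D0 \<eta> by (simp add: e_def)
  have "U \<in> measurable \<Omega> (Rd d)" unfolding U_def \<Omega>_def by (rule measurable_normalized[OF \<mu>0(2)])
  from W2_sq_gaussian_le[OF _ this psdS char e0 bound]
  have "W2_sq d (distr \<Omega> (Rd d) U) (gauss d) \<le> ennreal (real d * e\<^sup>2)"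
    by (simp add: \<Omega>_def prob_space_chain_space[OF \<mu>0(1)])
  then show ?thesis by (simp only: normalized_law_def U_def \<Omega>_def \<mu>0_def e_def)
qed

section \<open>Assembly with constants uniform in d and \<eta>\<close>

theorem theorem2p1:
  fixes \<alpha> \<beta> p C0 C1 :: real
  assumes "0 < \<alpha>" "\<alpha> \<le> \<beta>" "1 < p"
  shows
    "(\<exists>C. \<forall>d A \<eta> \<mu>0.
        good_A \<alpha> \<beta> d A \<and> 0 < \<eta> \<and> \<eta> \<le> 1
        \<and> sets \<mu>0 = sets (Rd d) \<and> prob_space \<mu>0
        \<and> (\<forall>i<d. integrable \<mu>0 (\<lambda>x. x i) \<and> (\<integral>x. x i \<partial>\<mu>0) = 0)
        \<and> (\<integral>\<^sup>+ x. ennreal (\<Sum>i<d. (x i)\<^sup>2) \<partial>\<mu>0) \<le> ennreal (C0 * real d)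
        \<longrightarrow> (let n = nat \<lfloor>\<eta> powr (- p)\<rfloor> in
             W2_sq d (normalized_law d A \<eta> n \<mu>0) (gauss d)
               \<le> ennreal ((C * (real n powr (1 / p - 1) * real d powr (3 / 2)
                     + real n powr (1 / (2 * p) - 1 / 2) * real d powr (1 / 2)))\<^sup>2)))
     \<and> (\<exists>C. \<forall>d A \<eta> \<Sigma>0.
        good_A \<alpha> \<beta> d A \<and> 0 < \<eta> \<and> \<eta> \<le> 1
        \<and> pos_def d \<Sigma>0 \<and> loewner_le d \<Sigma>0 (scal_id d C1)
        \<longrightarrow> (let n = nat \<lfloor>\<eta> powr (- p)\<rfloor> in
             W2_sq d (normalized_law d A \<eta> n (gaussian_law d \<Sigma>0)) (gauss d)
               \<le> ennreal ((C * (real n powr (1 / p - 1) * real d powr (3 / 2)))\<^sup>2)))"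
proof -
  obtain D where D1: "1 \<le> D" and D: "\<And>\<eta>. 0 < \<eta> \<Longrightarrow> \<eta> \<le> 1 \<Longrightarrow> \<exists>r\<ge>0. 1 - \<alpha> * \<eta> \<le> r \<and> \<beta> * \<eta> - 1 \<le> r
      \<and> (\<forall>m \<le> nat \<lfloor>\<eta> powr (- p)\<rfloor>. r ^ m \<le> D) \<and> (\<Sum>m < nat \<lfloor>\<eta> powr (- p)\<rfloor>. r ^ m) \<le> D / \<eta>"
    using contraction_constants[OF assms] by metis
  \<comment> \<open>The absolute values make the constants nonnegative for arbitrary real
    \<open>C0\<close> and \<open>C1\<close>; enlarging these two only weakens the moment and
    covariance bounds.\<close>
  define K where "K = (2 + 2 * D\<^sup>2) * \<bar>C0\<bar> + 2 * D\<^sup>2"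
  define K' where "K' = \<bar>C1\<bar> * (1 + D\<^sup>2) + (2 + D) * D"
  have K: "0 \<le> K" "0 \<le> K'" using D1 by (auto simp: K_def K'_def)
  show ?thesis
  proof (intro conjI)
    show "\<exists>C. \<forall>d A \<eta> \<mu>0.
        good_A \<alpha> \<beta> d A \<and> 0 < \<eta> \<and> \<eta> \<le> 1
        \<and> sets \<mu>0 = sets (Rd d) \<and> prob_space \<mu>0
        \<and> (\<forall>i<d. integrable \<mu>0 (\<lambda>x. x i) \<and> (\<integral>x. x i \<partial>\<mu>0) = 0)
        \<and> (\<integral>\<^sup>+ x. ennreal (\<Sum>i<d. (x i)\<^sup>2) \<partial>\<mu>0) \<le> ennreal (C0 * real d)
        \<longrightarrow> (let n = nat \<lfloor>\<eta> powr (- p)\<rfloor> in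
             W2_sq d (normalized_law d A \<eta> n \<mu>0) (gauss d)
               \<le> ennreal ((C * (real n powr (1 / p - 1) * real d powr (3 / 2)
                     + real n powr (1 / (2 * p) - 1 / 2) * real d powr (1 / 2)))\<^sup>2))"
    \<comment> \<open>The squared bound d K / (\<eta> n) is at most 2 K d n^(1/p - 1), which is the
      square of sqrt (2 K) times the summand of order d^(1/2); the factor 2 comes from the rounding
      of \<open>n\<close>.\<close>
    proof (rule exI[of _ "sqrt (2 * K)"], clarify, unfold Let_def)
      fix d A \<mu>0 and \<eta> :: real
      assume A: "good_A \<alpha> \<beta> d A" and \<eta>: "0 < \<eta>" "\<eta> \<le> 1" and \<mu>0: "sets \<mu>0 = sets (Rd d)" "prob_space \<mu>0"
        and m: "(\<integral>\<^sup>+ x. ennreal (\<Sum>i<d. (x i)\<^sup>2) \<partial>\<mu>0) \<le> ennreal (C0 * real d)"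
      define n where "n = nat \<lfloor>\<eta> powr (- p)\<rfloor>"
      obtain r where r: "0 \<le> r" "1 - \<alpha> * \<eta> \<le> r" "\<beta> * \<eta> - 1 \<le> r" "\<And>m. m \<le> n \<Longrightarrow> r ^ m \<le> D" "(\<Sum>m<n. r ^ m) \<le> D / \<eta>"
        using D[OF \<eta>] unfolding n_def by blast
      have n: "1 \<le> n" "1 / (\<eta> * n) \<le> 2 * real n powr (1 / p - 1)"
        using steps_rate[OF assms(3) \<eta> n_def] by auto
      have "C0 * real d \<le> \<bar>C0\<bar> * real d" by (intro mult_right_mono) auto
      then have m': "(\<integral>\<^sup>+ x. ennreal (\<Sum>i<d. (x i)\<^sup>2) \<partial>\<mu>0) \<le> ennreal (\<bar>C0\<bar> * real d)"
        using m by (meson ennreal_leI order_trans)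
      have "W2_sq d (normalized_law d A \<eta> n \<mu>0) (gauss d) \<le> ennreal (real d * K / (\<eta> * n))"
        unfolding K_def
        by (rule W2_sq_normalized_le[OF assms(1,2) A \<eta>(1) n(1) \<mu>0(2,1) abs_ge_zero m'
              op_bound_step_mat[OF A less_imp_le[OF \<eta>(1)] r(1-3)] r(4,5)])
      also have "real d * K / (\<eta> * n) \<le> (sqrt (2 * K) * (real n powr (1 / p - 1) * real d powr (3 / 2)
                     + real n powr (1 / (2 * p) - 1 / 2) * real d powr (1 / 2)))\<^sup>2"
      proof -
        define y where "y = real n powr (1 / (2 * p) - 1 / 2) * real d powr (1 / 2)"
        have "y\<^sup>2 = real n powr (1 / p - 1) * real d"
          by (simp add: y_def power2_eq_square mult_ac flip: powr_add)
        moreover have "real d * K / (\<eta> * n) = real d * K * (1 / (\<eta> * n))" by simp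
        moreover have "real d * K * (1 / (\<eta> * n)) \<le> real d * K * (2 * real n powr (1 / p - 1))"
          using K by (intro mult_left_mono n) auto
        ultimately have "real d * K / (\<eta> * n) \<le> (sqrt (2 * K) * y)\<^sup>2"
          using K by (simp add: power_mult_distrib mult_ac)
        \<comment> \<open>The estimate so far involves \<open>y\<close> alone; the summand of order
          d^(3/2) is nonnegative and only enlarges the right-hand side.\<close>
        also have "\<dots> \<le> (sqrt (2 * K) * (real n powr (1 / p - 1) * real d powr (3 / 2) + y))\<^sup>2"
          using K by (intro power_mono mult_left_mono) (auto simp: y_def)
        finally show ?thesis by (simp add: y_def)
      qed
      finally show "W2_sq d (normalized_law d A \<eta> (nat \<lfloor>\<eta> powr (- p)\<rfloor>) \<mu>0) (gauss d)
          \<le> ennreal ((sqrt (2 * K) * (real (nat \<lfloor>\<eta> powr (- p)\<rfloor>) powr (1 / p - 1) * real d powr (3 / 2)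
              + real (nat \<lfloor>\<eta> powr (- p)\<rfloor>) powr (1 / (2 * p) - 1 / 2) * real d powr (1 / 2)))\<^sup>2)"
        unfolding n_def[symmetric] by (simp add: ennreal_leI)
    qed
    show "\<exists>C. \<forall>d A \<eta> \<Sigma>0.
        good_A \<alpha> \<beta> d A \<and> 0 < \<eta> \<and> \<eta> \<le> 1
        \<and> pos_def d \<Sigma>0 \<and> loewner_le d \<Sigma>0 (scal_id d C1)
        \<longrightarrow> (let n = nat \<lfloor>\<eta> powr (- p)\<rfloor> in
             W2_sq d (normalized_law d A \<eta> n (gaussian_law d \<Sigma>0)) (gauss d)
               \<le> ennreal ((C * (real n powr (1 / p - 1) * real d powr (3 / 2)))\<^sup>2))"
    proof (rule exI[of _ "2 * K'"], clarify, unfold Let_def)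
      fix d A \<Sigma>0 and \<eta> :: real
      assume A: "good_A \<alpha> \<beta> d A" and \<eta>: "0 < \<eta>" "\<eta> \<le> 1"
        and S0: "pos_def d \<Sigma>0" "loewner_le d \<Sigma>0 (scal_id d C1)"
      define n where "n = nat \<lfloor>\<eta> powr (- p)\<rfloor>"
      obtain r where r: "0 \<le> r" "1 - \<alpha> * \<eta> \<le> r" "\<beta> * \<eta> - 1 \<le> r" "\<And>m. m \<le> n \<Longrightarrow> r ^ m \<le> D" "(\<Sum>m<n. r ^ m) \<le> D / \<eta>"
        using D[OF \<eta>] unfolding n_def by blast
      have n: "1 \<le> n" "1 / (\<eta> * n) \<le> 2 * real n powr (1 / p - 1)"
        using steps_rate[OF assms(3) \<eta> n_def] by auto
      have "C1 * dot d x x \<le> \<bar>C1\<bar> * dot d x x" for x by (intro mult_right_mono dot_self_nonneg) auto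
      then have S0': "loewner_le d \<Sigma>0 (scal_id d \<bar>C1\<bar>)"
        using S0(2) unfolding loewner_le_def quad_scale_id by (meson order_trans)
      have "W2_sq d (normalized_law d A \<eta> n (gaussian_law d \<Sigma>0)) (gauss d) \<le> ennreal (real d * (K' / (\<eta> * n))\<^sup>2)"
        unfolding K'_def
        by (rule W2_sq_normalized_gaussian_le[OF assms(1,2) A \<eta>(1) n(1) S0(1) S0' abs_ge_zero
              op_bound_step_mat[OF A less_imp_le[OF \<eta>(1)] r(1-3)] r(4,5)])
      also have "real d * (K' / (\<eta> * n))\<^sup>2 \<le> (2 * K' * (real n powr (1 / p - 1) * real d powr (3 / 2)))\<^sup>2"
      proof -
        have "K' / (\<eta> * n) = K' * (1 / (\<eta> * n))" by simp
        also have "\<dots> \<le> K' * (2 * real n powr (1 / p - 1))" using K by (intro mult_left_mono n) auto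
        finally have "(K' / (\<eta> * n))\<^sup>2 \<le> (2 * K' * real n powr (1 / p - 1))\<^sup>2"
          using K \<eta> by (intro power_mono) (auto simp: mult_ac)
        \<comment> \<open>The covariance comparison produces d^(1/2); for natural \<open>d\<close>
          one has d \<le> d^3, which gives the stated power.\<close>
        moreover have "real d \<le> (real d powr (3 / 2))\<^sup>2"
        proof (cases "d = 0")
          case False
          then have "(real d powr (3 / 2))\<^sup>2 = real d ^ 3" by (simp add: powr_power powr_numeral)
          then show ?thesis using False by (simp add: self_le_power)
        qed simp
        ultimately have "real d * (K' / (\<eta> * n))\<^sup>2 \<le> (real d powr (3 / 2))\<^sup>2 * (2 * K' * real n powr (1 / p - 1))\<^sup>2"
          by (intro mult_mono) auto
        then show ?thesis by (simp add: power_mult_distrib mult_ac)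
      qed
      finally show "W2_sq d (normalized_law d A \<eta> (nat \<lfloor>\<eta> powr (- p)\<rfloor>) (gaussian_law d \<Sigma>0)) (gauss d)
          \<le> ennreal ((2 * K' * (real (nat \<lfloor>\<eta> powr (- p)\<rfloor>) powr (1 / p - 1) * real d powr (3 / 2)))\<^sup>2)"
        unfolding n_def[symmetric] by (simp add: ennreal_leI)
    qed
  qed
qed

end
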